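(* Consider the job-based flow-time-plus-energy problem described in the context, in which all jobs are released at time $0$, the power function $P$ satisfies the stated power-function assumption, and the many-jobs scaling assumption holds. Then the job-SRPT algorithm with the speed rule $$s_k(t)=\begin{cases}P^{-1}\!\left(\frac{n(t)}{K}\right) & \text{if } n(t)\ge K,\\ P^{-1}(1) & \text{otherwise,}\end{cases}\qquad k=1,\dots,K,$$ (where $n(t)$ is the number of unfinished jobs at time $t$) has competitive ratio at most $$P\!\left(2-\tfrac{1}{K}\right)\left(2+\frac{2}{P^{-1}(1)}\max\bigl(1,P(\bar s)\bigr)\right)+o(1),$$ where $\bar s=\inf\{s>0: P(s)>s\}$ and the $o(1)$ term vanishes under the many-jobs scaling.
   Context: Model: there are $K$ identical servers. Server $k$ runs at time $t$ at a chosen speed $s_k(t)\ge 0$ (work processed per unit time) and consumes power $P(s_k(t))$. A finite set $\mathcal J$ of $\mathsf J$ jobs is given; job $i$ is released at time $a_i$ and consists of $m_i$ map tasks with sizes (work) $\mathsf m_{i1},\dots,\mathsf m_{im_i}$ and $r_i$ reduce tasks with sizes $\mathsf r_{i1},\dots,\mathsf r_{ir_i}$. Precedence (MapReduce) constraint: a reduce task of job $i$ may be processed only after all $m_i$ map tasks of job $i$ are completed. Preemption and migration are allowed, but a task cannot be processed on two servers simultaneously. A task is free at time $t$ if it may be processed at $t$ (map tasks are always free; a reduce task is free once all map tasks of its job are completed). The flow time of job $i$ is $T_i-a_i$ where $T_i$ is the completion time of the last task of job $i$. The job-based cost of a schedule is $C_{\text{job}}=\int n(t)\,dt+\int\sum_{k=1}^K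 P(s_k(t))\,dt$, where $n(t)$ is the number of unfinished jobs at time $t$. An online algorithm learns about job $i$ only at time $a_i$. The competitive ratio of an algorithm $A$ is $\sup_\sigma C^A(\sigma)/C^{\mathsf{OPT}}(\sigma)$ over inputs $\sigma$, where $\mathsf{OPT}$ is the minimum cost over all feasible schedules (choice of tasks and speeds) with full knowledge of the input. Power-function assumption: $P:\mathbb R_+\to\mathbb R_+$, $P(0)=0$, $P$ is differentiable, strictly increasing and strictly convex, $\bar s:=\inf\{s>0:P(s)>s\}<\infty$, $P(xy)\le P(x)P(y)$ for $x,y>0$, and $\Delta(x):=P'(P^{-1}(x))=o(x)$ as $x\to\infty$. Many-jobs scaling assumption: letting $w_j$ be the total size (sum of all map and reduce task sizes) of job $j$ and $w_{\max}=\max_j w_j$, the number of jobs $\mathsf J$ is large and $K\,w_{\max}\,\Delta(\mathsf J/K)=o\bigl(\sum_{j=1}^{\mathsf J}w_j\bigr)$. Job-SRPT algorithm: the cumulative remaining work of a job at time $t$ is the sum of the remaining sizes of all its (map and reduce) tasks. Order the $n(t)$ unfinished jobs by increasing cumulative remaining work. If $n(t)\ge K$, the $K$ jobs with smallest cumulative remaining work are processed, one per server, and each such server processes the shortest (smallest remaining size) free task of its job. If $n(t)<K$, each of the $n(t)$ jobs has its shortest free task processed on a distinct server, and the remaining $K-n(t)$ servers process the $K-n(t)$ shortest free tasks (among those not already being processed) across all unfinished jobs. *)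

theory Defs
  imports "HOL-Analysis.Analysis" "HOL-Library.Landau_Symbols"
begin

definition strictly_convex_on :: "real set \<Rightarrow> (real \<Rightarrow> real) \<Rightarrow> bool" where
  "strictly_convex_on S f \<longleftrightarrow> convex S \<and>
     (\<forall>x\<in>S. \<forall>y\<in>S. \<forall>u. x \<noteq> y \<and> 0 < u \<and> u < 1 \<longrightarrow>
        f (u * x + (1 - u) * y) < u * f x + (1 - u) * f y)"

definition Pinv :: "(real \<Rightarrow> real) \<Rightarrow> real \<Rightarrow> real" where
  "Pinv P x = the_inv_into {0..} P x"

definition Delta :: "(real \<Rightarrow> real) \<Rightarrow> real \<Rightarrow> real" where
  "Delta P x = deriv P (Pinv P x)"

definition sbar :: "(real \<Rightarrow> real) \<Rightarrow> real" where
  "sbar P = Inf {s. s > 0 \<and> P s > s}"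

definition power_fun_ok :: "(real \<Rightarrow> real) \<Rightarrow> bool" where
  "power_fun_ok P \<longleftrightarrow>
     (\<forall>x\<ge>0. P x \<ge> 0) \<and> P 0 = 0 \<and>
     (\<forall>x\<ge>0. P differentiable (at x within {0..})) \<and>
     strict_mono_on {0..} P \<and>
     strictly_convex_on {0..} P \<and>
     (\<exists>s>0. P s > s) \<and>
     (\<forall>x>0. \<forall>y>0. P (x * y) \<le> P x * P y) \<and>
     Delta P \<in> o[at_top](\<lambda>x. x)"

text \<open>Jobs are indexed 0..<njobs; job i has nmap i map tasks and nred i reduce tasks,
  with sizes msz i j (j < nmap i) and rsz i j (j < nred i).\<close>
record jobset =
  njobs :: nat
  nmap :: "nat \<Rightarrow> nat"
  nred :: "nat \<Rightarrow> nat"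
  msz :: "nat \<Rightarrow> nat \<Rightarrow> real"
  rsz :: "nat \<Rightarrow> nat \<Rightarrow> real"

datatype task = MapT nat nat | RedT nat nat

fun job_of :: "task \<Rightarrow> nat" where
  "job_of (MapT i j) = i"
| "job_of (RedT i j) = i"

definition tasks :: "jobset \<Rightarrow> task set" where
  "tasks I = {MapT i j |i j. i < njobs I \<and> j < nmap I i}
           \<union> {RedT i j |i j. i < njobs I \<and> j < nred I i}"

definition job_tasks :: "jobset \<Rightarrow> nat \<Rightarrow> task set" where
  "job_tasks I i = {\<tau> \<in> tasks I. job_of \<tau> = i}"

fun tsize :: "jobset \<Rightarrow> task \<Rightarrow> real" where
  "tsize I (MapT i j) = msz I i j"
| "tsize I (RedT i j) = rsz I i j"

definition valid_instance :: "jobset \<Rightarrow> bool" where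
  "valid_instance I \<longleftrightarrow> (\<forall>i<njobs I. nmap I i \<ge> 1) \<and> (\<forall>\<tau>\<in>tasks I. tsize I \<tau> > 0)"

definition job_work :: "jobset \<Rightarrow> nat \<Rightarrow> real" where
  "job_work I i = (\<Sum>\<tau>\<in>job_tasks I i. tsize I \<tau>)"

definition total_work :: "jobset \<Rightarrow> real" where
  "total_work I = (\<Sum>i<njobs I. job_work I i)"

definition max_work :: "jobset \<Rightarrow> real" where
  "max_work I = Max (job_work I ` {..<njobs I})"

text \<open>A schedule on K servers: asg k t is the task (if any) that server k processes at
  time t, spd k t its speed. Only times t >= 0 matter.\<close>
type_synonym assignment = "nat \<Rightarrow> real \<Rightarrow> task option"
type_synonym speeds = "nat \<Rightarrow> real \<Rightarrow> real"

definition work :: "nat \<Rightarrow> assignment \<Rightarrow> speeds \<Rightarrow> task \<Rightarrow> real \<Rightarrow> ennreal" where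
  "work K asg spd \<tau> t =
     (\<integral>\<^sup>+ u \<in> {0..t}. ennreal (\<Sum>k<K. if asg k u = Some \<tau> then spd k u else 0) \<partial>lborel)"

definition task_done :: "jobset \<Rightarrow> nat \<Rightarrow> assignment \<Rightarrow> speeds \<Rightarrow> task \<Rightarrow> real \<Rightarrow> bool" where
  "task_done I K asg spd \<tau> t \<longleftrightarrow> work K asg spd \<tau> t \<ge> ennreal (tsize I \<tau>)"

definition remaining :: "jobset \<Rightarrow> nat \<Rightarrow> assignment \<Rightarrow> speeds \<Rightarrow> task \<Rightarrow> real \<Rightarrow> real" where
  "remaining I K asg spd \<tau> t =
     (if task_done I K asg spd \<tau> t then 0 else tsize I \<tau> - enn2real (work K asg spd \<tau> t))"

definition job_remaining :: "jobset \<Rightarrow> nat \<Rightarrow> assignment \<Rightarrow> speeds \<Rightarrow> nat \<Rightarrow> real \<Rightarrow> real" where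
  "job_remaining I K asg spd i t = (\<Sum>\<tau>\<in>job_tasks I i. remaining I K asg spd \<tau> t)"

definition unfinished_jobs :: "jobset \<Rightarrow> nat \<Rightarrow> assignment \<Rightarrow> speeds \<Rightarrow> real \<Rightarrow> nat set" where
  "unfinished_jobs I K asg spd t =
     {i. i < njobs I \<and> (\<exists>\<tau>\<in>job_tasks I i. \<not> task_done I K asg spd \<tau> t)}"

definition nunf :: "jobset \<Rightarrow> nat \<Rightarrow> assignment \<Rightarrow> speeds \<Rightarrow> real \<Rightarrow> nat" where
  "nunf I K asg spd t = card (unfinished_jobs I K asg spd t)"

fun task_free :: "jobset \<Rightarrow> nat \<Rightarrow> assignment \<Rightarrow> speeds \<Rightarrow> task \<Rightarrow> real \<Rightarrow> bool" where
  "task_free I K asg spd (MapT i j) t = True"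
| "task_free I K asg spd (RedT i j) t =
     (\<forall>j'<nmap I i. task_done I K asg spd (MapT i j') t)"

definition feasible :: "jobset \<Rightarrow> nat \<Rightarrow> assignment \<Rightarrow> speeds \<Rightarrow> bool" where
  "feasible I K asg spd \<longleftrightarrow>
     (\<forall>k<K. spd k \<in> borel_measurable lborel) \<and>
     (\<forall>k<K. \<forall>\<tau>. {t. asg k t = Some \<tau>} \<in> sets lborel) \<and>
     (\<forall>k<K. \<forall>t\<ge>0. spd k t \<ge> 0) \<and>
     (\<forall>k<K. \<forall>t\<ge>0. \<forall>\<tau>. asg k t = Some \<tau> \<longrightarrow> \<tau> \<in> tasks I \<and> task_free I K asg spd \<tau> t) \<and>
     (\<forall>k<K. \<forall>k'<K. \<forall>t\<ge>0. \<forall>\<tau>. k \<noteq> k' \<and> asg k t = Some \<tau> \<longrightarrow> asg k' t \<noteq> Some \<tau>)"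

definition cost :: "jobset \<Rightarrow> nat \<Rightarrow> (real \<Rightarrow> real) \<Rightarrow> assignment \<Rightarrow> speeds \<Rightarrow> ennreal" where
  "cost I K P asg spd =
     (\<integral>\<^sup>+ t \<in> {0..}. ennreal (real (nunf I K asg spd t) + (\<Sum>k<K. P (spd k t))) \<partial>lborel)"

definition OPT :: "jobset \<Rightarrow> nat \<Rightarrow> (real \<Rightarrow> real) \<Rightarrow> ennreal" where
  "OPT I K P = (INF s \<in> {(asg, spd). feasible I K asg spd}. cost I K P (fst s) (snd s))"

definition free_tasks :: "jobset \<Rightarrow> nat \<Rightarrow> assignment \<Rightarrow> speeds \<Rightarrow> real \<Rightarrow> task set" where
  "free_tasks I K asg spd t =
     {\<tau> \<in> tasks I. task_free I K asg spd \<tau> t \<and> \<not> task_done I K asg spd \<tau> t}"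

definition serves_shortest :: "jobset \<Rightarrow> nat \<Rightarrow> assignment \<Rightarrow> speeds \<Rightarrow> nat \<Rightarrow> nat \<Rightarrow> real \<Rightarrow> bool" where
  "serves_shortest I K asg spd k i t \<longleftrightarrow>
     (\<exists>\<tau>. asg k t = Some \<tau> \<and> job_of \<tau> = i \<and> \<tau> \<in> free_tasks I K asg spd t \<and>
        (\<forall>\<tau>'\<in>free_tasks I K asg spd t. job_of \<tau>' = i \<longrightarrow>
            remaining I K asg spd \<tau> t \<le> remaining I K asg spd \<tau>' t))"

definition srpt_rule :: "jobset \<Rightarrow> nat \<Rightarrow> (real \<Rightarrow> real) \<Rightarrow> assignment \<Rightarrow> speeds \<Rightarrow> real \<Rightarrow> bool" where
  "srpt_rule I K P asg spd t \<longleftrightarrow>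
    (let U = unfinished_jobs I K asg spd t; n = card U;
         F = free_tasks I K asg spd t;
         rem = (\<lambda>\<tau>. remaining I K asg spd \<tau> t);
         jrem = (\<lambda>i. job_remaining I K asg spd i t) in
     if n = 0 then (\<forall>k<K. asg k t = None \<and> spd k t = 0)
     else if n \<ge> K then
       (\<forall>k<K. spd k t = Pinv P (real n / real K)) \<and>
       (\<exists>S g. S \<subseteq> U \<and> card S = K \<and>
          (\<forall>i\<in>S. \<forall>i'\<in>U - S. jrem i \<le> jrem i') \<and>
          bij_betw g {..<K} S \<and>
          (\<forall>k<K. serves_shortest I K asg spd k (g k) t))
     else
       (\<forall>k<K. spd k t = Pinv P 1) \<and>
       (\<exists>h. inj_on h U \<and> h ` U \<subseteq> {..<K} \<and>
          (\<forall>i\<in>U. serves_shortest I K asg spd (h i) i t) \<and>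
          (let A = {\<tau>. \<exists>i\<in>U. asg (h i) t = Some \<tau>};
               R = {..<K} - h ` U;
               B = {\<tau>. \<exists>k\<in>R. asg k t = Some \<tau>} in
           B \<subseteq> F - A \<and>
           ((\<forall>k\<in>R. asg k t \<noteq> None) \<or> F - A \<subseteq> B) \<and>
           (\<forall>\<tau>\<in>B. \<forall>\<tau>'\<in>(F - A) - B. rem \<tau> \<le> rem \<tau>'))))"

definition job_srpt_schedule :: "jobset \<Rightarrow> nat \<Rightarrow> (real \<Rightarrow> real) \<Rightarrow> assignment \<Rightarrow> speeds \<Rightarrow> bool" where
  "job_srpt_schedule I K P asg spd \<longleftrightarrow>
     feasible I K asg spd \<and>
     (AE t in lborel. t \<ge> 0 \<longrightarrow> srpt_rule I K P asg spd t)"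

definition srpt_bound :: "nat \<Rightarrow> (real \<Rightarrow> real) \<Rightarrow> real" where
  "srpt_bound K P = P (2 - 1 / real K) * (2 + 2 / Pinv P 1 * max 1 (P (sbar P)))"

end

theory Submission
  imports Defs
begin

text \<open>
  The algorithm is in fact asymptotically \<open>2\<close>-competitive, and the stated ratio is at least \<open>2\<close>.

  Let \<open>\<psi>(x) = x / P\<^sup>-\<^sup>1(x)\<close>, a nondecreasing function with \<open>\<psi>(x) s \<le> x + P(s)\<close>. With \<open>n\<close>
  unfinished jobs every schedule pays at least \<open>\<psi>(n/K)\<close> per unit of processed work, while the
  algorithm pays exactly \<open>2 \<psi>(n/K)\<close> as long as \<open>n \<ge> K\<close>. Writing \<open>\<psi>(n/K)\<close> as a sum of increments,
  one has to compare, for each \<open>m\<close>, the work processed while more than \<open>m\<close> jobs are unfinished. Any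
  schedule must by then have processed the least total work \<open>L m\<close> of a set of jobs leaving only \<open>m\<close>
  others. The algorithm works on the smallest jobs first, and at most \<open>K\<close> jobs are partly processed
  at a time, so it processes at most \<open>L m + K w_max\<close>. The excess sums to
  \<open>2 K w_max \<psi>(J/K) \<le> 2 K w_max \<Delta>(J/K)\<close>, and the phase \<open>n < K\<close> lasts at most \<open>w_max / P\<^sup>-\<^sup>1(1)\<close>;
  both are negligible against the total work, hence against the optimum.
\<close>

section \<open>Power functions\<close>

text \<open>At holding cost \<open>x\<close> per server, this is the least cost per unit of work up to a factor \<open>2\<close>.\<close>
definition energy_rate :: "(real \<Rightarrow> real) \<Rightarrow> real \<Rightarrow> real" where
  "energy_rate P x = x / Pinv P x"

locale power_function =
  fixes P :: "real \<Rightarrow> real"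
  assumes ok: "power_fun_ok P"
begin

lemma P_0: "P 0 = 0"
  and P_less: "0 \<le> x \<Longrightarrow> x < y \<Longrightarrow> P x < P y"
  and P_submult: "0 < x \<Longrightarrow> 0 < y \<Longrightarrow> P (x * y) \<le> P x * P y"
  and P_differentiable: "0 \<le> x \<Longrightarrow> P differentiable (at x within {0..})"
  using ok by (auto simp: power_fun_ok_def strict_mono_on_def)

lemma P_le: "0 \<le> x \<Longrightarrow> x \<le> y \<Longrightarrow> P x \<le> P y"
  using P_less[of x y] by (cases "x = y") auto

lemma P_pos: "0 < x \<Longrightarrow> 0 < P x"
  using P_less[of 0 x] P_0 by auto

lemma P_nonneg: "0 \<le> x \<Longrightarrow> 0 \<le> P x"
  using P_le[of 0 x] P_0 by auto

lemma P_convex: "convex_on {0..} P"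
proof (rule convex_onI)
  fix t x y :: real
  assume t: "0 < t" "t < 1" and x: "x \<in> {0..}" and y: "y \<in> {0..}"
  have sc: "strictly_convex_on {0..} P" using ok by (auto simp: power_fun_ok_def)
  show "P ((1 - t) *\<^sub>R x + t *\<^sub>R y) \<le> (1 - t) * P x + t * P y"
  proof (cases "x = y")
    case True
    then show ?thesis by (simp add: algebra_simps)
  next
    case False
    then have "P ((1 - t) * x + (1 - (1 - t)) * y) < (1 - t) * P x + (1 - (1 - t)) * P y"
      using sc t x y unfolding strictly_convex_on_def by (metis diff_gt_0_iff_gt diff_less_eq less_add_same_cancel1)
    then show ?thesis by simp
  qed
qed simp

lemma P_div_mono:
  assumes "0 < a" "a \<le> b"
  shows "P a / a \<le> P b / b"
proof -
  have "P ((1 - a/b) *\<^sub>R 0 + (a/b) *\<^sub>R b) \<le> (1 - a/b) * P 0 + (a/b) * P b"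
    using assms by (intro convex_onD[OF P_convex]) auto
  then have "P a \<le> (a/b) * P b" using assms by (simp add: P_0)
  then show ?thesis using assms by (simp add: field_simps)
qed

lemma P_1: "1 \<le> P 1"
  using P_submult[of 1 1] P_pos[of 1] by simp

lemma P_ge: "1 \<le> x \<Longrightarrow> x \<le> P x"
proof -
  assume x: "1 \<le> x"
  have "1 * x \<le> P 1 * x" using P_1 x by (intro mult_right_mono) auto
  also have "\<dots> \<le> P x" using P_div_mono[of 1 x] x by (simp add: field_simps)
  finally show ?thesis by simp
qed

lemma P_continuous: "continuous_on {0..} P"
  using P_differentiable by (simp add: continuous_on_eq_continuous_within differentiable_imp_continuous_within)

lemma P_surj:
  assumes "0 \<le> y" shows "\<exists>x\<ge>0. P x = y"
proof -
  have "y \<le> P (max 1 y)" using P_ge[of "max 1 y"] by auto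
  moreover have "continuous_on {0..max 1 y} P"
    using P_continuous by (rule continuous_on_subset) auto
  ultimately show ?thesis
    using IVT'[of P 0 y "max 1 y"] assms by (fastforce simp: P_0)
qed

lemma P_inj: "inj_on P {0..}"
  using ok by (auto simp: power_fun_ok_def intro: strict_mono_on_imp_inj_on)

lemma Pinv_nonneg: "0 \<le> y \<Longrightarrow> 0 \<le> Pinv P y"
  and P_Pinv: "0 \<le> y \<Longrightarrow> P (Pinv P y) = y"
proof -
  assume "0 \<le> y"
  then obtain x where "x \<ge> 0" "P x = y" using P_surj by blast
  then have "Pinv P y = x" unfolding Pinv_def using P_inj the_inv_into_f_f by fastforce
  then show "0 \<le> Pinv P y" "P (Pinv P y) = y" using \<open>x \<ge> 0\<close> \<open>P x = y\<close> by auto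
qed

lemma Pinv_pos: "0 < y \<Longrightarrow> 0 < Pinv P y"
  using Pinv_nonneg[of y] P_Pinv[of y] P_0 by (cases "Pinv P y = 0") auto

lemma Pinv_mono: "0 \<le> x \<Longrightarrow> x \<le> y \<Longrightarrow> Pinv P x \<le> Pinv P y"
  using P_less[of "Pinv P y" "Pinv P x"] Pinv_nonneg[of y] P_Pinv[of x] P_Pinv[of y] by fastforce

lemma energy_rate_pos: "0 < x \<Longrightarrow> 0 < energy_rate P x"
  by (simp add: energy_rate_def Pinv_pos)

lemma energy_rate_0 [simp]: "energy_rate P 0 = 0"
  by (simp add: energy_rate_def)

lemma energy_rate_nonneg: "0 \<le> x \<Longrightarrow> 0 \<le> energy_rate P x"
  by (simp add: energy_rate_def Pinv_nonneg)

lemma energy_rate_mono: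
  assumes "0 \<le> x" "x \<le> y" shows "energy_rate P x \<le> energy_rate P y"
proof (cases "x = 0")
  case True
  then show ?thesis using energy_rate_nonneg[of y] assms by simp
next
  case False
  then show ?thesis
    using P_div_mono[of "Pinv P x" "Pinv P y"] Pinv_pos[of x] Pinv_mono[of x y] assms
    by (simp add: energy_rate_def P_Pinv)
qed

text \<open>Below speed \<open>P\<^sup>-\<^sup>1(x)\<close> the holding cost \<open>x\<close> alone pays for the work,
  above it the power alone does.\<close>
lemma energy_rate_le_cost:
  assumes "0 \<le> x" "0 \<le> s" shows "energy_rate P x * s \<le> x + P s"
proof (cases "x = 0")
  case True
  then show ?thesis using P_nonneg assms by simp
next
  case False
  then have p: "0 < Pinv P x" using assms Pinv_pos by simp
  show ?thesis
  proof (cases "s \<le> Pinv P x")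
    case True
    then have "x * s \<le> x * Pinv P x" using assms by (simp add: mult_left_mono)
    then have "energy_rate P x * s \<le> x" using p by (simp add: energy_rate_def field_simps)
    then show ?thesis using P_nonneg[OF assms(2)] by simp
  next
    case False
    then have "energy_rate P x \<le> P s / s"
      using P_div_mono[OF p, of s] assms by (simp add: energy_rate_def P_Pinv)
    then have "energy_rate P x * s \<le> P s" using False p by (simp add: field_simps)
    then show ?thesis using assms by simp
  qed
qed

lemma energy_rate_le_Delta:
  assumes "0 < x" shows "energy_rate P x \<le> Delta P x"
proof -
  define s where "s = Pinv P x"
  have s: "0 < s" "P s = x" using Pinv_pos P_Pinv assms by (auto simp: s_def)
  have int: "s \<in> interior {0..}" using s by simp
  have "at s within {0..} = at s" using int by (rule at_within_interior)
  then have "P differentiable (at s)" using P_differentiable[of s] s by simp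
  then have D: "(P has_field_derivative deriv P s) (at s within {0..})"
    by (simp add: DERIV_deriv_iff_real_differentiable has_field_derivative_at_within)
  have "P 0 - P s \<ge> deriv P s * (0 - s)"
    by (rule convex_on_imp_above_tangent[OF P_convex _ int _ D]) auto
  then show ?thesis using s by (simp add: P_0 energy_rate_def Delta_def s_def[symmetric] field_simps)
qed

end

section \<open>Cumulative integrals of rates\<close>

definition cumul ::"(real \<Rightarrow> real) \<Rightarrow> real \<Rightarrow> real" where
  "cumul f t = (LINT u:{0..t}|lborel. f u)"

definition rate_function :: "(real \<Rightarrow> real) \<Rightarrow> bool" where
  "rate_function f \<longleftrightarrow> f \<in> borel_measurable borel \<and> (\<forall>u. 0 \<le> f u) \<and>
     (\<forall>t. (\<integral>\<^sup>+ u\<in>{0..t}. ennreal (f u) \<partial>lborel) < \<infinity>)"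

lemma rate_function_set_integrable:
  assumes "rate_function f" "0 \<le> s" shows "set_integrable lborel {s..t} f"
proof -
  have "(\<integral>\<^sup>+ u. ennreal (indicator {s..t} u *\<^sub>R f u) \<partial>lborel)
      \<le> (\<integral>\<^sup>+ u\<in>{0..t}. ennreal (f u) \<partial>lborel)"
    using assms by (intro nn_integral_mono) (auto simp: indicator_def)
  also have "\<dots> < \<infinity>" using assms by (auto simp: rate_function_def)
  finally show ?thesis unfolding set_integrable_def
    using assms by (intro integrableI_nonneg) (auto simp: rate_function_def)
qed

lemma ennreal_cumul:
  assumes "rate_function f"
  shows "ennreal (cumul f t) = (\<integral>\<^sup>+ u\<in>{0..t}. ennreal (f u) \<partial>lborel)"
proof -
  have "(\<integral>\<^sup>+ u. ennreal (indicator {0..t} u *\<^sub>R f u) \<partial>lborel) = ennreal (cumul f t)"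
    unfolding cumul_def set_lebesgue_integral_def
    using assms rate_function_set_integrable[OF assms, of 0 t]
    by (intro nn_integral_eq_integral) (auto simp: rate_function_def set_integrable_def)
  also have "(\<integral>\<^sup>+ u. ennreal (indicator {0..t} u *\<^sub>R f u) \<partial>lborel)
      = (\<integral>\<^sup>+ u\<in>{0..t}. ennreal (f u) \<partial>lborel)"
    by (intro nn_integral_cong) (auto simp: indicator_def)
  finally show ?thesis ..
qed

lemma cumul_nonneg: "rate_function f \<Longrightarrow> 0 \<le> cumul f t"
  unfolding cumul_def set_lebesgue_integral_def rate_function_def
  by (intro Bochner_Integration.integral_nonneg) auto

lemma cumul_0 [simp]: "cumul f 0 = 0"
proof -
  have "AE u in lborel. u \<noteq> (0::real)" by (rule AE_lborel_singleton)
  then have "AE u in lborel. indicator {0..0} u *\<^sub>R f u = 0" by eventually_elim auto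
  then show ?thesis unfolding cumul_def set_lebesgue_integral_def by (rule integral_eq_zero_AE)
qed

lemma cumul_continuous:
  assumes "rate_function f" shows "continuous_on {0..b} (cumul f)"
proof -
  have "f integrable_on {0..b}"
    using set_borel_integral_eq_integral(1)[OF rate_function_set_integrable[OF assms, of 0 b]] by simp
  then have "continuous_on {0..b} (\<lambda>t. integral {0..t} f)"
    by (rule indefinite_integral_continuous_1)
  then show ?thesis
    using set_borel_integral_eq_integral(2)[OF rate_function_set_integrable[OF assms order_refl]]
    unfolding cumul_def by simp
qed

lemma cumul_split:
  assumes "rate_function f" "0 \<le> s" "s \<le> t"
  shows "cumul f t = cumul f s + (LINT u:{s..t}|lborel. f u)"
proof -
  have "{0..t} = {0..s} \<union> {s..t}" using assms by auto
  moreover have "AE x in lborel. \<not> (x \<in> {0..s} \<and> x \<in> {s..t})"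
  proof -
    have "AE x in lborel. x \<noteq> s" by (rule AE_lborel_singleton)
    then show ?thesis by eventually_elim auto
  qed
  ultimately show ?thesis unfolding cumul_def
    using rate_function_set_integrable[OF assms(1)] assms(2)
    by (simp only:) (rule set_integral_Un_AE, auto)
qed

lemma cumul_diff_mono:
  assumes f: "rate_function f" and g: "rate_function g" and "0 \<le> s" "s \<le> t"
    and "AE u in lborel. s \<le> u \<and> u \<le> t \<longrightarrow> f u \<le> g u"
  shows "cumul f t - cumul f s \<le> cumul g t - cumul g s"
proof -
  have "(LINT u:{s..t}|lborel. f u) \<le> (LINT u:{s..t}|lborel. g u)"
    unfolding set_lebesgue_integral_def
  proof (rule integral_mono_AE)
    show "AE u in lborel. indicator {s..t} u *\<^sub>R f u \<le> indicator {s..t} u *\<^sub>R g u"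
      using assms(5) by eventually_elim (auto simp: indicator_def)
  qed (use rate_function_set_integrable[OF f, of s t] rate_function_set_integrable[OF g, of s t] \<open>0 \<le> s\<close>
      in \<open>auto simp: set_integrable_def\<close>)
  then show ?thesis
    using cumul_split[OF f \<open>0 \<le> s\<close> \<open>s \<le> t\<close>] cumul_split[OF g \<open>0 \<le> s\<close> \<open>s \<le> t\<close>] by linarith
qed

lemma rate_function_zero: "rate_function (\<lambda>_. 0)"
  by (simp add: rate_function_def)

lemma cumul_zero: "cumul (\<lambda>_. 0) t = 0"
  by (simp add: cumul_def set_lebesgue_integral_def)

lemma cumul_mono:
  assumes "rate_function f" "0 \<le> s" "s \<le> t" shows "cumul f s \<le> cumul f t"
  using cumul_diff_mono[OF rate_function_zero assms(1-3)] assms(1)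
  by (auto simp: cumul_zero rate_function_def)

lemma cumul_diff_eq_0:
  assumes "rate_function f" "0 \<le> s" "s \<le> t" "AE u in lborel. s \<le> u \<and> u \<le> t \<longrightarrow> f u = 0"
  shows "cumul f t = cumul f s"
proof -
  have "AE u in lborel. s \<le> u \<and> u \<le> t \<longrightarrow> f u \<le> 0" using assms(4) by eventually_elim auto
  then show ?thesis
    using cumul_diff_mono[OF assms(1) rate_function_zero assms(2,3)] cumul_mono[OF assms(1-3)]
    by (auto simp: cumul_zero)
qed

lemma rate_function_sum:
  assumes "\<And>i. i \<in> A \<Longrightarrow> rate_function (f i)"
  shows "rate_function (\<lambda>u. \<Sum>i\<in>A. f i u)"
proof (cases "finite A")
  case True
  have "(\<integral>\<^sup>+ u\<in>{0..t}. ennreal (\<Sum>i\<in>A. f i u) \<partial>lborel) < \<infinity>" for t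
  proof -
    have "(\<integral>\<^sup>+ u\<in>{0..t}. ennreal (\<Sum>i\<in>A. f i u) \<partial>lborel)
        = (\<integral>\<^sup>+ u. (\<Sum>i\<in>A. ennreal (f i u) * indicator {0..t} u) \<partial>lborel)"
    proof (rule nn_integral_cong)
      fix u
      have "(\<Sum>i\<in>A. ennreal (f i u)) = ennreal (\<Sum>i\<in>A. f i u)"
        using assms by (intro sum_ennreal) (auto simp: rate_function_def)
      then show "ennreal (\<Sum>i\<in>A. f i u) * indicator {0..t} u
          = (\<Sum>i\<in>A. ennreal (f i u) * indicator {0..t} u)"
        by (simp add: sum_distrib_right flip: \<open>(\<Sum>i\<in>A. ennreal (f i u)) = _\<close>)
    qed
    also have "\<dots> = (\<Sum>i\<in>A. \<integral>\<^sup>+ u\<in>{0..t}. ennreal (f i u) \<partial>lborel)"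
      using assms by (intro nn_integral_sum borel_measurable_times_ennreal)
        (auto simp: rate_function_def)
    also have "\<dots> < \<infinity>"
      using assms True by (auto simp: rate_function_def less_top)
    finally show ?thesis .
  qed
  then show ?thesis
    using assms by (auto simp: rate_function_def intro!: sum_nonneg borel_measurable_sum)
qed (simp add: rate_function_zero)

lemma cumul_sum:
  assumes "\<And>i. i \<in> A \<Longrightarrow> rate_function (f i)"
  shows "cumul (\<lambda>u. \<Sum>i\<in>A. f i u) t = (\<Sum>i\<in>A. cumul (f i) t)"
  unfolding cumul_def set_lebesgue_integral_def scaleR_sum_right
  using rate_function_set_integrable[OF assms, of _ 0 t]
  by (intro Bochner_Integration.integral_sum) (auto simp: set_integrable_def)

lemma cumul_eq_imp_AE_eq:
  assumes f: "rate_function f" and g: "rate_function g" and "0 \<le> a"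
    and eq: "\<And>v. 0 \<le> v \<Longrightarrow> v \<le> a \<Longrightarrow> cumul f v = cumul g v"
  shows "AE u in lborel. 0 \<le> u \<and> u \<le> a \<longrightarrow> f u = g u"
proof -
  have em: "emeasure (density lborel (\<lambda>u. ennreal (h u) * indicator {0..a} u)) {x<..}
      = (if x < 0 then cumul h a else if x \<le> a then ennreal (cumul h a - cumul h x) else 0)"
    if h: "rate_function h" for h x
  proof -
    have hm: "h \<in> borel_measurable borel" using h by (simp add: rate_function_def)
    have E: "emeasure (density lborel (\<lambda>u. ennreal (h u) * indicator {0..a} u)) {x<..}
        = (\<integral>\<^sup>+ u. ennreal (h u) * indicator {0..a} u * indicator {x<..} u \<partial>lborel)"
      using hm by (intro emeasure_density) auto
    consider "x < 0" | "0 \<le> x" "x \<le> a" | "a < x" by linarith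
    then show ?thesis
    proof cases
      case 1
      then have "emeasure (density lborel (\<lambda>u. ennreal (h u) * indicator {0..a} u)) {x<..}
        = (\<integral>\<^sup>+ u\<in>{0..a}. ennreal (h u) \<partial>lborel)"
        unfolding E by (intro nn_integral_cong) (auto simp: indicator_def)
      then show ?thesis using 1 ennreal_cumul[OF h] by simp
    next
      case 2
      have "AE u in lborel. u \<noteq> x" by (rule AE_lborel_singleton)
      then have "AE u in lborel. ennreal (h u) * indicator {0..a} u * indicator {x<..} u
          = ennreal (indicator {x..a} u *\<^sub>R h u)"
        by eventually_elim (use 2 in \<open>auto simp: indicator_def\<close>)
      then have "emeasure (density lborel (\<lambda>u. ennreal (h u) * indicator {0..a} u)) {x<..}
        = (\<integral>\<^sup>+ u. ennreal (indicator {x..a} u *\<^sub>R h u) \<partial>lborel)"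
        unfolding E by (rule nn_integral_cong_AE)
      also have "\<dots> = ennreal (LINT u:{x..a}|lborel. h u)"
        unfolding set_lebesgue_integral_def
        using h rate_function_set_integrable[OF h, of x a] 2
        by (intro nn_integral_eq_integral) (auto simp: rate_function_def set_integrable_def)
      finally show ?thesis using 2 cumul_split[OF h, of x a] by simp
    next
      case 3
      then have "emeasure (density lborel (\<lambda>u. ennreal (h u) * indicator {0..a} u)) {x<..}
        = (\<integral>\<^sup>+ u. 0 \<partial>(lborel::real measure))"
        unfolding E by (intro nn_integral_cong) (auto simp: indicator_def)
      then show ?thesis using 3 \<open>0 \<le> a\<close> by simp
    qed
  qed
  have m: "f \<in> borel_measurable borel" "g \<in> borel_measurable borel"
    using f g by (auto simp: rate_function_def)
  have "density lborel (\<lambda>u. ennreal (f u) * indicator {0..a} u)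
      = density lborel (\<lambda>u. ennreal (g u) * indicator {0..a} u)"
    by (rule measure_eqI_lessThan) (use em[OF f] em[OF g] eq \<open>0 \<le> a\<close> in auto)
  then have "AE u in lborel. ennreal (f u) * indicator {0..a} u = ennreal (g u) * indicator {0..a} u"
    using m ennreal_cumul[OF f, of a, symmetric] by (subst (asm) finite_density_unique) auto
  then show ?thesis
    by eventually_elim (use f g in \<open>auto simp: rate_function_def\<close>)
qed

lemma rate_function_le:
  assumes "rate_function g" "f \<in> borel_measurable borel" "\<And>u. 0 \<le> f u" "\<And>u. f u \<le> g u"
  shows "rate_function f"
proof -
  have "(\<integral>\<^sup>+ u\<in>{0..t}. ennreal (f u) \<partial>lborel) < \<infinity>" for t
  proof -
    have "(\<integral>\<^sup>+ u\<in>{0..t}. ennreal (f u) \<partial>lborel) \<le> (\<integral>\<^sup>+ u\<in>{0..t}. ennreal (g u) \<partial>lborel)"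
      using assms(4) by (intro nn_integral_mono mult_right_mono ennreal_leI) auto
    then show ?thesis using assms(1) by (auto simp: rate_function_def intro: le_less_trans)
  qed
  then show ?thesis using assms by (auto simp: rate_function_def)
qed

lemma rate_function_const: "0 \<le> c \<Longrightarrow> rate_function (\<lambda>_. c)"
  by (simp add: rate_function_def nn_integral_cmult_indicator ennreal_mult_less_top emeasure_lborel_Icc_eq)

lemma cumul_const: "0 \<le> t \<Longrightarrow> cumul (\<lambda>_. c) t = c * t"
  by (simp add: cumul_def set_lebesgue_integral_def)

section \<open>Schedules\<close>

text \<open>The least total work of a set of jobs whose completion leaves at most \<open>m\<close> jobs unfinished.\<close>
definition least_work :: "jobset \<Rightarrow> nat \<Rightarrow> real" where
  "least_work I m = Min (sum (job_work I) ` {A. A \<subseteq> {..<njobs I} \<and> njobs I \<le> card A + m})"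

lemma finite_tasks: "finite (tasks I)"
proof -
  have "tasks I \<subseteq> (\<lambda>(i, j). MapT i j) ` (SIGMA i:{..<njobs I}. {..<nmap I i})
      \<union> (\<lambda>(i, j). RedT i j) ` (SIGMA i:{..<njobs I}. {..<nred I i})"
    by (force simp: tasks_def)
  then show ?thesis by (rule finite_subset) auto
qed

lemma finite_job_tasks: "finite (job_tasks I i)"
  using finite_tasks by (simp add: job_tasks_def)

lemma sum_job_tasks: "(\<Sum>i<njobs I. \<Sum>\<tau>\<in>job_tasks I i. f \<tau>) = (\<Sum>\<tau>\<in>tasks I. f \<tau>)"
  unfolding job_tasks_def
  by (rule sum.group) (auto simp: finite_tasks, auto simp: tasks_def)

lemma least_work_le:
  "A \<subseteq> {..<njobs I} \<Longrightarrow> njobs I \<le> card A + m \<Longrightarrow> least_work I m \<le> sum (job_work I) A"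
  unfolding least_work_def by (rule Min_le) auto

lemma least_work_attained:
  obtains A where "A \<subseteq> {..<njobs I}" "njobs I \<le> card A + m" "least_work I m = sum (job_work I) A"
proof -
  have "least_work I m \<in> sum (job_work I) ` {A. A \<subseteq> {..<njobs I} \<and> njobs I \<le> card A + m}"
    unfolding least_work_def
  proof (rule Min_in)
    show "sum (job_work I) ` {A. A \<subseteq> {..<njobs I} \<and> njobs I \<le> card A + m} \<noteq> {}"
      using card_lessThan[of "njobs I"] by (auto intro!: exI[of _ "{..<njobs I}"])
  qed auto
  then show thesis using that by auto
qed

lemma least_work_0: "least_work I 0 = total_work I"
proof -
  obtain A where A: "A \<subseteq> {..<njobs I}" "njobs I \<le> card A + 0" "least_work I 0 = sum (job_work I) A"
    by (rule least_work_attained)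
  then have "A = {..<njobs I}" by (intro card_subset_eq) (auto dest: card_mono[rotated])
  then show ?thesis using A by (simp add: total_work_def)
qed

lemma job_work_le_max_work: "i < njobs I \<Longrightarrow> job_work I i \<le> max_work I"
  unfolding max_work_def by (rule Max_ge) auto

context
  fixes I :: jobset
  assumes valid: "valid_instance I"
begin

lemma tsize_pos: "\<tau> \<in> tasks I \<Longrightarrow> 0 < tsize I \<tau>"
  using valid by (simp add: valid_instance_def)

lemma job_work_pos:
  assumes "i < njobs I" shows "0 < job_work I i"
  unfolding job_work_def
proof (rule sum_pos)
  have "MapT i 0 \<in> job_tasks I i"
    using valid assms by (force simp: valid_instance_def job_tasks_def tasks_def)
  then show "job_tasks I i \<noteq> {}" by auto
qed (auto simp: finite_job_tasks, auto simp: job_tasks_def tsize_pos)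

lemma least_work_nonneg: "0 \<le> least_work I m"
  by (rule least_work_attained[of I m]) (auto intro!: sum_nonneg less_imp_le[OF job_work_pos])

end

locale schedule =
  fixes I :: jobset and K :: nat and asg :: assignment and spd :: speeds
  assumes valid: "valid_instance I" and feasible: "feasible I K asg spd"
begin

abbreviation "U \<equiv> unfinished_jobs I K asg spd"
abbreviation "n \<equiv> nunf I K asg spd"

lemma work_mono: "s \<le> t \<Longrightarrow> work K asg spd \<tau> s \<le> work K asg spd \<tau> t"
  unfolding work_def by (intro nn_integral_mono mult_left_mono) (auto simp: indicator_def)

lemma task_done_mono: "s \<le> t \<Longrightarrow> task_done I K asg spd \<tau> s \<Longrightarrow> task_done I K asg spd \<tau> t"
  unfolding task_done_def using work_mono order_trans by blast

lemma U_antimono: "s \<le> t \<Longrightarrow> U t \<subseteq> U s"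
  using task_done_mono by (force simp: unfinished_jobs_def)

lemma U_subset: "U t \<subseteq> {..<njobs I}"
  by (auto simp: unfinished_jobs_def)

lemma finite_U: "finite (U t)"
  using U_subset by (rule finite_subset) simp

lemma n_antimono: "s \<le> t \<Longrightarrow> n t \<le> n s"
  unfolding nunf_def by (intro card_mono finite_U U_antimono)

lemma n_le: "n t \<le> njobs I"
  unfolding nunf_def using card_mono[OF _ U_subset] by simp

lemma n_measurable: "(\<lambda>t. real (n t)) \<in> borel_measurable borel"
proof -
  have "mono (\<lambda>t. - real (n t))" using n_antimono by (auto intro: monoI)
  then have "(\<lambda>t. - (- real (n t))) \<in> borel_measurable borel"
    by (intro borel_measurable_uminus borel_measurable_mono)
  then show ?thesis by simp
qed

lemma n_greater_sets: "{t. m < n t} \<in> sets borel"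
proof -
  have "{t \<in> space borel. real m < real (n t)} \<in> sets borel"
    using n_measurable by (intro borel_measurable_less) auto
  then show ?thesis by simp
qed

text \<open>Rates are cut off at negative times, where a schedule is unconstrained.\<close>
definition total_speed :: "real \<Rightarrow> real" where
  "total_speed u = (if 0 \<le> u then \<Sum>k<K. spd k u else 0)"

definition rate :: "task \<Rightarrow> real \<Rightarrow> real" where
  "rate \<tau> u = (if 0 \<le> u then \<Sum>k<K. if asg k u = Some \<tau> then spd k u else 0 else 0)"

definition job_rate :: "nat \<Rightarrow> real \<Rightarrow> real" where
  "job_rate i u = (\<Sum>\<tau>\<in>job_tasks I i. rate \<tau> u)"

lemma spd_nonneg: "k < K \<Longrightarrow> 0 \<le> u \<Longrightarrow> 0 \<le> spd k u"
  using feasible by (simp add: feasible_def)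

lemma spd_measurable: "k < K \<Longrightarrow> spd k \<in> borel_measurable borel"
  using feasible by (simp add: feasible_def)

lemma total_speed_nonneg: "0 \<le> total_speed u"
  by (auto simp: total_speed_def intro!: sum_nonneg spd_nonneg)

lemma total_speed_measurable: "total_speed \<in> borel_measurable borel"
  unfolding total_speed_def using spd_measurable by (intro measurable_If borel_measurable_sum) auto

lemma rate_nonneg: "0 \<le> rate \<tau> u"
  by (auto simp: rate_def intro!: sum_nonneg spd_nonneg)

lemma rate_measurable: "rate \<tau> \<in> borel_measurable borel"
proof -
  have "(\<lambda>u. if asg k u = Some \<tau> then spd k u else 0) \<in> borel_measurable borel" if "k < K" for k
    using that feasible spd_measurable by (intro measurable_If) (auto simp: feasible_def)
  then have "(\<lambda>u. \<Sum>k<K. if asg k u = Some \<tau> then spd k u else 0) \<in> borel_measurable borel"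
    by (intro borel_measurable_sum) auto
  then show ?thesis unfolding rate_def by (intro measurable_If) auto
qed

lemma sum_rate: "u \<ge> 0 \<Longrightarrow> finite A \<Longrightarrow>
    (\<Sum>\<tau>\<in>A. rate \<tau> u) = (\<Sum>k<K. if \<exists>\<tau>\<in>A. asg k u = Some \<tau> then spd k u else 0)"
proof -
  assume u: "u \<ge> 0" and A: "finite A"
  have "(\<Sum>\<tau>\<in>A. rate \<tau> u) = (\<Sum>k<K. \<Sum>\<tau>\<in>A. if asg k u = Some \<tau> then spd k u else 0)"
    using u by (simp add: rate_def) (rule sum.swap)
  also have "\<dots> = (\<Sum>k<K. if \<exists>\<tau>\<in>A. asg k u = Some \<tau> then spd k u else 0)"
  proof (rule sum.cong)
    fix k
    show "(\<Sum>\<tau>\<in>A. if asg k u = Some \<tau> then spd k u else 0)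
        = (if \<exists>\<tau>\<in>A. asg k u = Some \<tau> then spd k u else 0)"
      using A by (cases "asg k u") auto
  qed simp
  finally show ?thesis .
qed

lemma sum_rate_le: "finite A \<Longrightarrow> (\<Sum>\<tau>\<in>A. rate \<tau> u) \<le> total_speed u"
proof (cases "u \<ge> 0")
  case True
  assume "finite A"
  then show ?thesis
    using True by (auto simp: sum_rate total_speed_def spd_nonneg intro!: sum_mono)
qed (simp add: rate_def total_speed_def)

lemma work_eq: "work K asg spd \<tau> t = (\<integral>\<^sup>+ u\<in>{0..t}. ennreal (rate \<tau> u) \<partial>lborel)"
  unfolding work_def rate_def by (intro nn_integral_cong) (auto simp: indicator_def)

end

locale finite_schedule = schedule +
  assumes total_speed_rate: "rate_function total_speed"
begin

lemma rate_rate: "rate_function (rate \<tau>)"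
  using total_speed_rate rate_measurable rate_nonneg
proof (rule rate_function_le)
  show "rate \<tau> u \<le> total_speed u" for u using sum_rate_le[of "{\<tau>}"] by simp
qed

lemma job_rate_rate: "rate_function (job_rate i)"
  unfolding job_rate_def by (intro rate_function_sum rate_rate)

lemma cumul_job_rate: "cumul (job_rate i) t = (\<Sum>\<tau>\<in>job_tasks I i. cumul (rate \<tau>) t)"
  unfolding job_rate_def by (intro cumul_sum rate_rate)

lemma work_cumul: "work K asg spd \<tau> t = ennreal (cumul (rate \<tau>) t)"
  by (simp add: work_eq ennreal_cumul rate_rate)

lemma task_done_iff: "task_done I K asg spd \<tau> t \<longleftrightarrow> tsize I \<tau> \<le> cumul (rate \<tau>) t"
  by (simp add: task_done_def work_cumul cumul_nonneg rate_rate)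

lemma least_work_le_cumul:
  assumes "n t \<le> m" "0 \<le> t" shows "least_work I m \<le> cumul total_speed t"
proof -
  let ?A = "{..<njobs I} - U t"
  have "card ?A = njobs I - n t"
    using U_subset finite_U by (simp add: card_Diff_subset nunf_def)
  then have "least_work I m \<le> sum (job_work I) ?A"
    using assms n_le[of t] by (intro least_work_le) auto
  also have "\<dots> \<le> (\<Sum>i\<in>?A. cumul (job_rate i) t)"
    unfolding cumul_job_rate job_work_def
    by (intro sum_mono) (auto simp: unfinished_jobs_def task_done_iff)
  also have "\<dots> \<le> (\<Sum>i<njobs I. cumul (job_rate i) t)"
    by (intro sum_mono2) (auto intro: cumul_nonneg job_rate_rate)
  also have "\<dots> = cumul (\<lambda>u. \<Sum>\<tau>\<in>tasks I. rate \<tau> u) t"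
    by (simp add: cumul_job_rate sum_job_tasks cumul_sum rate_rate)
  also have "\<dots> \<le> cumul total_speed t"
    using cumul_diff_mono[OF rate_function_sum[of "tasks I" rate] total_speed_rate, of 0 t] assms
    by (auto simp: sum_rate_le finite_tasks rate_rate)
  finally show ?thesis .
qed

end

section \<open>Lower bound for every schedule\<close>

definition (in power_function) rate_step :: "nat \<Rightarrow> nat \<Rightarrow> real" where
  "rate_step K m = energy_rate P (real (Suc m) / real K) - energy_rate P (real m / real K)"

context power_function
begin

lemma rate_step_nonneg: "0 \<le> rate_step K m"
  unfolding rate_step_def by (simp add: energy_rate_mono divide_right_mono)

lemma sum_rate_step: "(\<Sum>m<j. rate_step K m) = energy_rate P (real j / real K)"
  unfolding rate_step_def
  using sum_lessThan_telescope[of "\<lambda>m. energy_rate P (real m / real K)" j] by simp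

text \<open>Layer-cake decomposition: it turns integrals of the cost rate against the processed work
  into the work processed while more than \<open>m\<close> jobs are unfinished.\<close>
lemma energy_rate_layers:
  assumes "j \<le> J"
  shows "energy_rate P (real j / real K) = (\<Sum>m<J. rate_step K m * indicator {..<j} m)"
proof -
  have "(\<Sum>m<J. rate_step K m * indicator {..<j} m) = (\<Sum>m<j. rate_step K m)"
    using assms by (intro sum.mono_neutral_cong_right) auto
  then show ?thesis by (simp add: sum_rate_step)
qed

lemma ennreal_energy_rate_layers:
  assumes "j \<le> J" "0 \<le> s"
  shows "ennreal (energy_rate P (real j / real K) * s)
    = (\<Sum>m<J. ennreal (rate_step K m) * (ennreal s * indicator {..<j} m))"
proof -
  have "energy_rate P (real j / real K) * s = (\<Sum>m<J. rate_step K m * (s * indicator {..<j} m))"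
    unfolding energy_rate_layers[OF assms(1)] sum_distrib_right by (intro sum.cong) auto
  also have "ennreal \<dots> = (\<Sum>m<J. ennreal (rate_step K m * (s * indicator {..<j} m)))"
    using assms by (intro sum_ennreal[symmetric]) (auto simp: rate_step_nonneg)
  also have "\<dots> = (\<Sum>m<J. ennreal (rate_step K m) * (ennreal s * indicator {..<j} m))"
    using assms by (intro sum.cong) (auto simp: ennreal_mult rate_step_nonneg indicator_def)
  finally show ?thesis .
qed

end

locale powered_schedule = schedule + power_function +
  assumes K_pos: "1 \<le> K"
begin

lemma energy_rate_total_speed:
  assumes "0 \<le> x" "0 \<le> u"
  shows "energy_rate P (x / real K) * total_speed u \<le> x + (\<Sum>k<K. P (spd k u))"
proof -
  have "energy_rate P (x / real K) * total_speed u = (\<Sum>k<K. energy_rate P (x / real K) * spd k u)"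
    using assms by (simp add: total_speed_def sum_distrib_left)
  also have "\<dots> \<le> (\<Sum>k<K. x / real K + P (spd k u))"
    using assms by (intro sum_mono energy_rate_le_cost) (auto simp: spd_nonneg)
  finally show ?thesis using K_pos by (simp add: sum.distrib)
qed

lemma total_speed_rate_of_finite_cost:
  assumes "cost I K P asg spd < \<infinity>"
  shows "rate_function total_speed"
proof -
  define c where "c u = (\<Sum>k<K. P (max 0 (spd k u)))" for u
  define e where "e = energy_rate P (1 / real K)"
  have e: "0 < e" using K_pos by (simp add: e_def energy_rate_pos)
  have "continuous_on UNIV (\<lambda>x. P (max 0 x))"
    by (rule continuous_on_compose2[OF P_continuous]) (auto intro!: continuous_intros)
  then have "(\<lambda>x. P (max 0 x)) \<in> borel_measurable borel"
    by (rule borel_measurable_continuous_onI)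
  then have c_meas: "c \<in> borel_measurable borel"
    unfolding c_def by (intro borel_measurable_sum measurable_compose[OF spd_measurable]) auto
  have c_nonneg: "0 \<le> c u" for u by (auto simp: c_def intro!: sum_nonneg P_nonneg)
  have "(\<integral>\<^sup>+ u\<in>{0..t}. ennreal (total_speed u) \<partial>lborel) < \<infinity>" for t
  proof -
    have "(\<integral>\<^sup>+ u\<in>{0..t}. ennreal (total_speed u) \<partial>lborel)
        \<le> (\<integral>\<^sup>+ u. ennreal (1 / e) * (indicator {0..t} u + ennreal (c u) * indicator {0..} u) \<partial>lborel)"
    proof (rule nn_integral_mono)
      fix u :: real
      show "ennreal (total_speed u) * indicator {0..t} u
          \<le> ennreal (1 / e) * (indicator {0..t} u + ennreal (c u) * indicator {0..} u)"
      proof (cases "u \<in> {0..t}")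
        case True
        then have u: "0 \<le> u" by simp
        then have "c u = (\<Sum>k<K. P (spd k u))"
          unfolding c_def by (intro sum.cong) (auto simp: spd_nonneg max_def)
        then have "e * total_speed u \<le> 1 + c u"
          using energy_rate_total_speed[of 1 u] u by (simp add: e_def)
        then have "total_speed u \<le> (1 / e) * (1 + c u)" using e by (simp add: field_simps)
        then have "ennreal (total_speed u) \<le> ennreal ((1 / e) * (1 + c u))" by (rule ennreal_leI)
        also have "\<dots> = ennreal (1 / e) * (1 + ennreal (c u))"
          using e c_nonneg[of u] by (subst ennreal_mult) auto
        finally show ?thesis using True by simp
      qed simp
    qed
    also have "\<dots> = ennreal (1 / e) *
        ((\<integral>\<^sup>+ u. indicator {0..t} u \<partial>lborel) + (\<integral>\<^sup>+ u. ennreal (c u) * indicator {0..} u \<partial>lborel))"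
      using c_meas by (subst nn_integral_cmult nn_integral_add; measurable)+
    also have "(\<integral>\<^sup>+ u. ennreal (c u) * indicator {0..} u \<partial>lborel) \<le> cost I K P asg spd"
      unfolding cost_def
    proof (intro nn_integral_mono)
      fix u :: real
      show "ennreal (c u) * indicator {0..} u
        \<le> ennreal (real (n u) + (\<Sum>k<K. P (spd k u))) * indicator {0..} u"
      proof (cases "0 \<le> u")
        case True
        then have "c u = (\<Sum>k<K. P (spd k u))"
          unfolding c_def by (intro sum.cong) (auto simp: spd_nonneg max_def)
        then show ?thesis by (auto intro!: mult_right_mono ennreal_leI)
      qed simp
    qed
    finally have "(\<integral>\<^sup>+ u\<in>{0..t}. ennreal (total_speed u) \<partial>lborel)
        \<le> ennreal (1 / e) * ((\<integral>\<^sup>+ u. indicator {0..t} u \<partial>lborel) + cost I K P asg spd)"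
      by (simp add: mult_left_mono add_left_mono)
    also have "\<dots> < \<infinity>"
      using assms by (auto simp: ennreal_mult_less_top emeasure_lborel_Icc_eq)
    finally show ?thesis .
  qed
  then show ?thesis
    using total_speed_measurable total_speed_nonneg by (auto simp: rate_function_def)
qed

lemma least_work_le_integral:
  assumes fin: "cost I K P asg spd < \<infinity>"
  shows "ennreal (least_work I m) \<le> (\<integral>\<^sup>+ u. ennreal (total_speed u) * indicator {..<n u} m \<partial>lborel)"
proof -
  interpret finite_schedule
    by unfold_locales (rule total_speed_rate_of_finite_cost[OF fin])
  define Z where "Z = {t. 0 \<le> t \<and> n t \<le> m}"
  have "Z \<noteq> {}"
  proof
    assume "Z = {}"
    then have n: "1 \<le> n t" if "0 \<le> t" for t using that by (force simp: Z_def)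
    have "emeasure lborel {0::real..} = \<infinity>"
    proof (rule ccontr)
      assume "\<not> ?thesis"
      then obtain N :: nat where N: "emeasure lborel {0::real..} < of_nat N"
        using ennreal_Ex_less_of_nat by (auto simp: less_top)
      have "of_nat N = emeasure lborel {0..real N}" by (simp add: ennreal_of_nat_eq_real_of_nat)
      also have "\<dots> \<le> emeasure lborel {0::real..}" by (intro emeasure_mono) auto
      finally show False using N by simp
    qed
    then have "\<infinity> = (\<integral>\<^sup>+ u. indicator {0..} u \<partial>(lborel :: real measure))" by simp
    also have "\<dots> \<le> cost I K P asg spd" unfolding cost_def
    proof (intro nn_integral_mono)
      fix u :: real
      show "indicator {0..} u \<le> ennreal (real (n u) + (\<Sum>k<K. P (spd k u))) * indicator {0..} u"
      proof (cases "0 \<le> u")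
        case True
        then have "0 \<le> (\<Sum>k<K. P (spd k u))" by (auto intro!: sum_nonneg P_nonneg spd_nonneg)
        then have "1 \<le> real (n u) + (\<Sum>k<K. P (spd k u))" using n[OF True] by linarith
        then show ?thesis using True ennreal_leI[of 1] by simp
      qed simp
    qed
    finally show False using fin by simp
  qed
  define T where "T = Inf Z"
  have bdd: "bdd_below Z" by (auto simp: Z_def intro: bdd_belowI[of _ 0])
  have T0: "0 \<le> T" unfolding T_def using \<open>Z \<noteq> {}\<close> by (intro cInf_greatest) (auto simp: Z_def)
  have before: "m < n u" if "0 \<le> u" "u < T" for u
    using that bdd cInf_lower[of u Z] by (force simp: T_def Z_def)
  have "least_work I m \<le> cumul total_speed T"
  proof (rule ccontr)
    assume "\<not> ?thesis"
    then have less: "cumul total_speed T < least_work I m" by simp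
    have "continuous_on {0..T+1} (cumul total_speed)"
      by (rule cumul_continuous[OF total_speed_rate])
    then have "(cumul total_speed \<longlongrightarrow> cumul total_speed T) (at T within {0..T+1})"
      using T0 by (auto simp: continuous_on)
    then have "\<forall>\<^sub>F t in at T within {0..T+1}. cumul total_speed t < least_work I m"
      using less by (rule order_tendstoD(2))
    then obtain d where d: "d > 0"
      "\<And>t. t \<in> {0..T+1} \<Longrightarrow> t \<noteq> T \<Longrightarrow> dist t T < d \<Longrightarrow> cumul total_speed t < least_work I m"
      unfolding eventually_at by blast
    have "Inf Z < T + min d 1" using d by (simp add: T_def)
    then obtain t where t: "t \<in> Z" "t < T + min d 1" using \<open>Z \<noteq> {}\<close> bdd by (auto simp: cInf_less_iff)
    have "T \<le> t" using t bdd by (auto simp: T_def intro: cInf_lower)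
    then have "cumul total_speed t < least_work I m"
      using d(2)[of t] less t T0 by (cases "t = T") (auto simp: dist_real_def)
    then show False using least_work_le_cumul[of t m] t by (simp add: Z_def)
  qed
  then have "ennreal (least_work I m) \<le> ennreal (cumul total_speed T)" by (rule ennreal_leI)
  also have "\<dots> = (\<integral>\<^sup>+ u\<in>{0..T}. ennreal (total_speed u) \<partial>lborel)"
    by (rule ennreal_cumul[OF total_speed_rate])
  also have "\<dots> \<le> (\<integral>\<^sup>+ u. ennreal (total_speed u) * indicator {..<n u} m \<partial>lborel)"
  proof (rule nn_integral_mono_AE)
    have "AE u in lborel. u \<noteq> T" by (rule AE_lborel_singleton)
    then show "AE u in lborel. ennreal (total_speed u) * indicator {0..T} u
        \<le> ennreal (total_speed u) * indicator {..<n u} m"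
      by eventually_elim (use before in \<open>auto simp: indicator_def\<close>)
  qed
  finally show ?thesis .
qed

lemma layer_measurable: "(\<lambda>u. ennreal (total_speed u) * indicator {..<n u} m) \<in> borel_measurable borel"
proof -
  have "(\<lambda>u. indicator {..<n u} m :: ennreal) = indicator {t. m < n t}"
    by (auto simp: indicator_def)
  then show ?thesis
    using n_greater_sets[of m] total_speed_measurable
    by (auto intro!: borel_measurable_times_ennreal borel_measurable_indicator)
qed

lemma cost_lower_bound:
  "ennreal (\<Sum>m<njobs I. rate_step K m * least_work I m) \<le> cost I K P asg spd"
proof (cases "cost I K P asg spd < \<infinity>")
  case fin: True
  have "ennreal (\<Sum>m<njobs I. rate_step K m * least_work I m)
      = (\<Sum>m<njobs I. ennreal (rate_step K m) * ennreal (least_work I m))"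
    using rate_step_nonneg least_work_nonneg[OF valid]
    by (subst sum_ennreal[symmetric]) (auto simp: ennreal_mult)
  also have "\<dots> \<le> (\<Sum>m<njobs I. ennreal (rate_step K m)
      * (\<integral>\<^sup>+ u. ennreal (total_speed u) * indicator {..<n u} m \<partial>lborel))"
    by (intro sum_mono mult_left_mono least_work_le_integral fin) auto
  also have "\<dots> = (\<Sum>m<njobs I. \<integral>\<^sup>+ u. ennreal (rate_step K m)
      * (ennreal (total_speed u) * indicator {..<n u} m) \<partial>lborel)"
    using layer_measurable by (simp add: nn_integral_cmult)
  also have "\<dots> = (\<integral>\<^sup>+ u. (\<Sum>m<njobs I. ennreal (rate_step K m)
      * (ennreal (total_speed u) * indicator {..<n u} m)) \<partial>lborel)"
    using layer_measurable by (intro nn_integral_sum[symmetric]) auto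
  also have "\<dots> = (\<integral>\<^sup>+ u. ennreal (energy_rate P (real (n u) / real K) * total_speed u) \<partial>lborel)"
    by (intro nn_integral_cong ennreal_energy_rate_layers[symmetric] n_le total_speed_nonneg)
  also have "\<dots> \<le> cost I K P asg spd" unfolding cost_def
  proof (rule nn_integral_mono)
    fix u :: real
    show "ennreal (energy_rate P (real (n u) / real K) * total_speed u)
        \<le> ennreal (real (n u) + (\<Sum>k<K. P (spd k u))) * indicator {0..} u"
    proof (cases "0 \<le> u")
      case True
      then show ?thesis using energy_rate_total_speed[of "real (n u)" u] by (simp add: ennreal_leI)
    qed (simp add: total_speed_def)
  qed
  finally show ?thesis .
qed (simp add: less_top[symmetric])

end

section \<open>Structure of job-SRPT schedules\<close>

lemma continuous_positive_nondecreasing: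
  fixes g :: "real \<Rightarrow> real"
  assumes cont: "continuous_on {a..b} g" and "a \<le> b" and pos: "0 < g a"
    and step: "\<And>c d. a \<le> c \<Longrightarrow> c \<le> d \<Longrightarrow> d \<le> b \<Longrightarrow> (\<And>u. c \<le> u \<Longrightarrow> u \<le> d \<Longrightarrow> 0 < g u) \<Longrightarrow> g c \<le> g d"
  shows "g a \<le> g b"
proof -
  define Z where "Z = {u \<in> {a..b}. g u \<le> 0}"
  have "Z = {}"
  proof (rule ccontr)
    assume ne: "Z \<noteq> {}"
    have "closed Z" unfolding Z_def
      using cont by (intro continuous_closed_preimage_constant continuous_on_closed_Collect_le) (auto intro: continuous_intros)
    moreover have bdd: "bdd_below Z" by (auto simp: Z_def intro: bdd_belowI[of _ a])
    ultimately have zZ: "Inf Z \<in> Z" using ne by (intro closed_contains_Inf)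
    define z where "z = Inf Z"
    have z: "a \<le> z" "z \<le> b" "g z \<le> 0" using zZ by (auto simp: Z_def z_def)
    then have az: "a < z" using pos by (cases "a = z") auto
    have before: "0 < g u" if "a \<le> u" "u < z" for u
      using that z cInf_lower[OF _ bdd, of u] by (force simp: Z_def z_def)
    have "continuous_on {a..z} g" using cont z by (auto intro: continuous_on_subset)
    then have "(g \<longlongrightarrow> g z) (at z within {a..z})" using az by (auto simp: continuous_on)
    then have "(g \<longlongrightarrow> g z) (at_left z)" using az by (simp add: at_within_Icc_at_left)
    moreover have "\<forall>\<^sub>F d in at_left z. g a \<le> g d"
    proof -
      have "\<forall>\<^sub>F d in at_left z. d \<in> {a<..<z}" using az by (rule eventually_at_leftI[rotated]) auto
      then show ?thesis
        by eventually_elim (use step[of a] before z in force)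
    qed
    ultimately have "g a \<le> g z" by (intro tendsto_lowerbound) auto
    then show False using pos z by simp
  qed
  then have "0 < g u" if "a \<le> u" "u \<le> b" for u using that by (force simp: Z_def)
  then show ?thesis using step[of a b] \<open>a \<le> b\<close> by simp
qed

lemma sum_smallest_le:
  fixes w :: "nat \<Rightarrow> real"
  assumes Y: "finite Y" and A: "finite A" and card: "card Y \<le> card A + k"
    and small: "\<And>i x. i \<in> Y \<Longrightarrow> x \<in> A - Y \<Longrightarrow> w i \<le> w x"
    and bound: "\<And>i. i \<in> Y \<Longrightarrow> w i \<le> M" and nonneg: "\<And>i. i \<in> Y \<union> A \<Longrightarrow> 0 \<le> w i" and "0 \<le> M"
  shows "sum w Y \<le> sum w A + real k * M"
proof (cases "Y = {}")
  case True
  then show ?thesis using nonneg \<open>0 \<le> M\<close> by (auto intro!: add_nonneg_nonneg sum_nonneg)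
next
  case False
  define q where "q = Max (w ` Y)"
  have "q \<in> w ` Y" unfolding q_def using Y False by (intro Max_in) auto
  then have q: "0 \<le> q" "q \<le> M" "\<And>x. x \<in> A - Y \<Longrightarrow> q \<le> w x" using nonneg bound small by auto
  have qY: "w i \<le> q" if "i \<in> Y" for i unfolding q_def using that Y by auto
  have "card (Y - A) + card (Y \<inter> A) = card Y" "card (A - Y) + card (Y \<inter> A) = card A"
    using Y A by (simp_all add: card_Diff_subset_Int Int_commute card_mono le_add_diff_inverse2)
  then have c: "card (Y - A) \<le> card (A - Y) + k" using card by linarith
  have "sum w (Y - A) \<le> real (card (Y - A)) * q"
    using qY by (intro sum_bounded_above) auto
  also have "\<dots> \<le> real (card (A - Y) + k) * q" using c q by (intro mult_right_mono) auto
  also have "\<dots> \<le> sum w (A - Y) + real k * M"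
  proof -
    have "real (card (A - Y)) * q \<le> sum w (A - Y)" using q by (intro sum_bounded_below) auto
    moreover have "real k * q \<le> real k * M" using q by (intro mult_left_mono) auto
    ultimately show ?thesis by (simp add: algebra_simps)
  qed
  finally have "sum w (Y - A) \<le> sum w (A - Y) + real k * M" .
  moreover have "sum w Y = sum w (Y - A) + sum w (Y \<inter> A)" "sum w A = sum w (A - Y) + sum w (Y \<inter> A)"
    using sum.Int_Diff[OF Y, of w A] sum.Int_Diff[OF A, of w Y] by (simp_all add: Int_commute)
  ultimately show ?thesis by simp
qed

locale srpt_schedule = powered_schedule +
  assumes srpt: "job_srpt_schedule I K P asg spd"
begin

lemma AE_srpt_rule: "AE u in lborel. 0 \<le> u \<longrightarrow> srpt_rule I K P asg spd u"
  using srpt by (simp add: job_srpt_schedule_def)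

lemma rule_idle:
  assumes "srpt_rule I K P asg spd u" "n u = 0"
  shows "\<forall>k<K. spd k u = 0"
  using assms by (simp add: srpt_rule_def nunf_def)

lemma rule_busy:
  assumes "srpt_rule I K P asg spd u" "K \<le> n u"
  shows "\<forall>k<K. spd k u = Pinv P (real (n u) / real K)"
    and "\<exists>S g. S \<subseteq> U u \<and> card S = K \<and>
      (\<forall>i\<in>S. \<forall>i'\<in>U u - S. job_remaining I K asg spd i u \<le> job_remaining I K asg spd i' u) \<and>
      bij_betw g {..<K} S \<and> (\<forall>k<K. serves_shortest I K asg spd k (g k) u)"
  using assms K_pos by (auto simp: srpt_rule_def Let_def nunf_def)

lemma rule_tail:
  assumes "srpt_rule I K P asg spd u" "0 < n u" "n u < K"
  shows "\<forall>k<K. spd k u = Pinv P 1"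
    and "\<exists>h. h ` U u \<subseteq> {..<K} \<and> (\<forall>i\<in>U u. serves_shortest I K asg spd (h i) i u) \<and>
      (\<forall>k\<in>{..<K} - h ` U u. \<forall>\<tau>. asg k u = Some \<tau> \<longrightarrow> \<tau> \<in> free_tasks I K asg spd u)"
proof -
  have "card (U u) \<noteq> 0" "\<not> K \<le> card (U u)" using assms by (auto simp: nunf_def)
  note r = assms(1)[unfolded srpt_rule_def Let_def, simplified this if_False]
  show "\<forall>k<K. spd k u = Pinv P 1" using r by blast
  obtain h where h: "h ` U u \<subseteq> {..<K}" "\<forall>i\<in>U u. serves_shortest I K asg spd (h i) i u"
     "{\<tau>. \<exists>k\<in>{..<K} - h ` U u. asg k u = Some \<tau>} \<subseteq> free_tasks I K asg spd u - {\<tau>. \<exists>i\<in>U u. asg (h i) u = Some \<tau>}"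
    using r by blast
  have "\<forall>k\<in>{..<K} - h ` U u. \<forall>\<tau>. asg k u = Some \<tau> \<longrightarrow> \<tau> \<in> free_tasks I K asg spd u"
    using h(3) by blast
  then show "\<exists>h. h ` U u \<subseteq> {..<K} \<and> (\<forall>i\<in>U u. serves_shortest I K asg spd (h i) i u) \<and>
      (\<forall>k\<in>{..<K} - h ` U u. \<forall>\<tau>. asg k u = Some \<tau> \<longrightarrow> \<tau> \<in> free_tasks I K asg spd u)"
    using h by blast
qed

lemma rule_speed_le:
  assumes "srpt_rule I K P asg spd u" "k < K"
  shows "spd k u \<le> Pinv P (real (njobs I)) + Pinv P 1"
proof -
  have nn: "0 \<le> Pinv P (real (njobs I))" "0 \<le> Pinv P 1" by (auto intro: Pinv_nonneg)
  consider "n u = 0" | "K \<le> n u" | "0 < n u" "n u < K" by linarith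
  then show ?thesis
  proof cases
    case 2
    have "real (n u) / real K \<le> real (n u) / 1" using K_pos by (intro divide_left_mono) auto
    also have "\<dots> \<le> real (njobs I)" using n_le by simp
    finally have "Pinv P (real (n u) / real K) \<le> Pinv P (real (njobs I))" by (intro Pinv_mono) auto
    then show ?thesis using rule_busy(1)[OF assms(1) 2] assms nn by auto
  qed (use rule_idle rule_tail(1) assms nn in auto)
qed

lemma rule_serves_unfinished:
  assumes rule: "srpt_rule I K P asg spd u" and k: "k < K" and a: "asg k u = Some \<tau>"
  shows "\<not> task_done I K asg spd \<tau> u"
proof -
  have "\<tau> \<in> free_tasks I K asg spd u"
  proof -
    consider "n u = 0" | "K \<le> n u" | "0 < n u" "n u < K" by linarith
    then show ?thesis
    proof cases
      case 1
      then show ?thesis using rule k a by (simp add: srpt_rule_def nunf_def)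
    next
      case 2
      then show ?thesis using rule_busy(2)[OF rule 2] k a by (auto simp: serves_shortest_def)
    next
      case 3
      then show ?thesis using rule_tail(2)[OF rule 3] k a by (force simp: serves_shortest_def)
    qed
  qed
  then show ?thesis by (simp add: free_tasks_def)
qed

sublocale finite_schedule
proof
  define C where "C = real K * (Pinv P (real (njobs I)) + Pinv P 1)"
  have "AE u in lborel. total_speed u \<le> C"
    using AE_srpt_rule
  proof eventually_elim
    case (elim u)
    show ?case
    proof (cases "0 \<le> u")
      case True
      then have "(\<Sum>k<K. spd k u) \<le> (\<Sum>k<K. Pinv P (real (njobs I)) + Pinv P 1)"
        using elim by (intro sum_mono rule_speed_le) auto
      then show ?thesis using True by (simp add: total_speed_def C_def)
    next
      case False
      then show ?thesis by (simp add: total_speed_def C_def Pinv_nonneg)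
    qed
  qed
  have "(\<integral>\<^sup>+ u\<in>{0..t}. ennreal (total_speed u) \<partial>lborel) < \<infinity>" for t
  proof -
    have "(\<integral>\<^sup>+ u\<in>{0..t}. ennreal (total_speed u) \<partial>lborel) \<le> (\<integral>\<^sup>+ u\<in>{0..t}. ennreal C \<partial>lborel)"
    proof (rule nn_integral_mono_AE)
      show "AE u in lborel. ennreal (total_speed u) * indicator {0..t} u \<le> ennreal C * indicator {0..t} u"
        using \<open>AE u in lborel. total_speed u \<le> C\<close>
        by eventually_elim (auto intro: mult_right_mono ennreal_leI)
    qed
    also have "\<dots> = ennreal C * emeasure lborel {0..t}" by (rule nn_integral_cmult_indicator) simp
    also have "\<dots> < \<infinity>" by (simp add: ennreal_mult_less_top emeasure_lborel_Icc_eq)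
    finally show ?thesis .
  qed
  then show "rate_function total_speed"
    using total_speed_measurable total_speed_nonneg by (auto simp: rate_function_def)
qed

lemma cumul_rate_le_tsize:
  assumes \<tau>: "\<tau> \<in> tasks I" and t: "0 \<le> t"
  shows "cumul (rate \<tau>) t \<le> tsize I \<tau>"
proof (rule ccontr)
  assume "\<not> ?thesis"
  then have "tsize I \<tau> \<le> cumul (rate \<tau>) t" "tsize I \<tau> \<noteq> cumul (rate \<tau>) t" by auto
  moreover have "cumul (rate \<tau>) 0 \<le> tsize I \<tau>" using tsize_pos[OF valid \<tau>] by simp
  ultimately obtain s where s: "0 \<le> s" "s \<le> t" "cumul (rate \<tau>) s = tsize I \<tau>"
    using IVT'[of "cumul (rate \<tau>)" 0 "tsize I \<tau>" t] cumul_continuous[OF rate_rate] t by auto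
  have "AE u in lborel. s \<le> u \<and> u \<le> t \<longrightarrow> rate \<tau> u = 0"
    using AE_srpt_rule
  proof eventually_elim
    case (elim u)
    show ?case
    proof safe
      assume u: "s \<le> u" "u \<le> t"
      then have "task_done I K asg spd \<tau> u"
        using s cumul_mono[OF rate_rate[of \<tau>], of s u] by (simp add: task_done_iff)
      then have "\<forall>k<K. asg k u \<noteq> Some \<tau>" using rule_serves_unfinished elim u s by force
      then show "rate \<tau> u = 0" by (auto simp: rate_def)
    qed
  qed
  then have "cumul (rate \<tau>) t = cumul (rate \<tau>) s"
    using s by (intro cumul_diff_eq_0 rate_rate) auto
  then show False using s \<open>tsize I \<tau> \<noteq> cumul (rate \<tau>) t\<close> by simp
qed

abbreviation "processed i \<equiv> cumul (job_rate i)"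
abbreviation "jrem \<equiv> job_remaining I K asg spd"

lemma jrem_eq: "0 \<le> t \<Longrightarrow> jrem i t = job_work I i - processed i t"
proof -
  assume t: "0 \<le> t"
  have "remaining I K asg spd \<tau> t = tsize I \<tau> - cumul (rate \<tau>) t" if "\<tau> \<in> job_tasks I i" for \<tau>
    using that cumul_rate_le_tsize[of \<tau> t] t
    by (auto simp: remaining_def task_done_iff work_cumul cumul_nonneg rate_rate job_tasks_def)
  then show ?thesis
    unfolding job_remaining_def job_work_def cumul_job_rate by (simp add: sum_subtractf)
qed

lemma processed_le: "0 \<le> t \<Longrightarrow> processed i t \<le> job_work I i"
  unfolding cumul_job_rate job_work_def by (intro sum_mono cumul_rate_le_tsize) (auto simp: job_tasks_def)

lemma U_iff:
  assumes "0 \<le> t" shows "i \<in> U t \<longleftrightarrow> i < njobs I \<and> 0 < jrem i t"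
proof -
  have "0 < jrem i t \<longleftrightarrow> (\<exists>\<tau>\<in>job_tasks I i. cumul (rate \<tau>) t < tsize I \<tau>)" (is "?l \<longleftrightarrow> ?r")
  proof
    assume ?l
    show ?r
    proof (rule ccontr)
      assume "\<not> ?r"
      then have "job_work I i \<le> processed i t"
        unfolding job_work_def cumul_job_rate by (intro sum_mono) auto
      then show False using \<open>?l\<close> jrem_eq[OF assms] by simp
    qed
  next
    assume ?r
    then have "processed i t < job_work I i" unfolding job_work_def cumul_job_rate
      using cumul_rate_le_tsize assms
      by (intro sum_strict_mono_ex1 finite_job_tasks) (auto simp: job_tasks_def)
    then show ?l using jrem_eq[OF assms] by simp
  qed
  then show ?thesis by (auto simp: unfinished_jobs_def task_done_iff not_le)
qed

definition serves :: "nat set \<Rightarrow> real \<Rightarrow> bool" where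
  "serves S u \<longleftrightarrow> S \<subseteq> U u \<and> card S = K \<and> (\<forall>i\<in>S. \<forall>i'\<in>U u - S. jrem i u \<le> jrem i' u) \<and>
     (\<forall>i. job_rate i u = (if i \<in> S then Pinv P (real (n u) / real K) else 0))"

lemma rule_serves:
  assumes rule: "srpt_rule I K P asg spd u" and u: "0 \<le> u" and n: "K \<le> n u"
  shows "\<exists>S. serves S u"
proof -
  obtain S g where S: "S \<subseteq> U u" "card S = K" "\<forall>i\<in>S. \<forall>i'\<in>U u - S. jrem i u \<le> jrem i' u"
    and g: "bij_betw g {..<K} S" "\<forall>k<K. serves_shortest I K asg spd k (g k) u"
    using rule_busy(2)[OF rule n] by blast
  define s where "s = Pinv P (real (n u) / real K)"
  have spd: "\<forall>k<K. spd k u = s" using rule_busy(1)[OF rule n] by (simp add: s_def)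
  have "job_rate i u = (if i \<in> S then s else 0)" for i
  proof -
    have "(\<exists>\<tau>\<in>job_tasks I i. asg k u = Some \<tau>) \<longleftrightarrow> g k = i" if "k < K" for k
      using g(2) that by (force simp: serves_shortest_def job_tasks_def free_tasks_def)
    then have "job_rate i u = (\<Sum>k<K. if g k = i then s else 0)"
      unfolding job_rate_def sum_rate[OF u finite_job_tasks] using spd by (intro sum.cong) auto
    also have "\<dots> = (\<Sum>j\<in>S. if j = i then s else 0)"
      using g(1) by (rule sum.reindex_bij_betw)
    also have "\<dots> = (if i \<in> S then s else 0)"
      using finite_subset[OF S(1) finite_U] by (simp add: sum.delta)
    finally show ?thesis .
  qed
  then show ?thesis unfolding serves_def using S s_def by blast
qed

lemma AE_serves: "AE u in lborel. 0 \<le> u \<and> K \<le> n u \<longrightarrow> (\<exists>S. serves S u)"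
  using AE_srpt_rule by eventually_elim (auto intro: rule_serves)

lemma speed_pos: "K \<le> n u \<Longrightarrow> 0 < Pinv P (real (n u) / real K)"
  using K_pos by (intro Pinv_pos) auto

lemma serves_priority:
  assumes "serves S u" "i \<in> U u" "jrem i u < jrem j u"
  shows "job_rate j u \<le> job_rate i u"
proof (cases "j \<in> S")
  case True
  then have "i \<in> S" using assms by (force simp: serves_def)
  then show ?thesis using True assms by (simp add: serves_def)
next
  case False
  then have "job_rate j u = 0" using assms by (simp add: serves_def)
  moreover have "0 \<le> job_rate i u" by (simp add: job_rate_def sum_nonneg rate_nonneg)
  ultimately show ?thesis by simp
qed

lemma jrem_continuous: "0 \<le> a \<Longrightarrow> continuous_on {a..b} (jrem i)"
proof -
  assume a: "0 \<le> a"
  have "continuous_on {a..b} (\<lambda>t. job_work I i - processed i t)"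
    using a by (intro continuous_intros continuous_on_subset[OF cumul_continuous[OF job_rate_rate]]) auto
  then show ?thesis by (rule continuous_on_eq) (use a jrem_eq in auto)
qed

context
  fixes t :: real
  assumes t: "0 \<le> t" "K \<le> n t"
begin

lemma AE_serves_before: "AE u in lborel. 0 \<le> u \<and> u \<le> t \<longrightarrow> (\<exists>S. serves S u)"
  using AE_serves by eventually_elim (use t n_antimono order_trans in blast)

lemma jrem_gap_mono:
  assumes i: "i \<in> U t" and a: "0 \<le> a" "a \<le> b" "b \<le> t" and gap: "jrem i a < jrem j a"
  shows "jrem j a - jrem i a \<le> jrem j b - jrem i b"
proof (rule continuous_positive_nondecreasing[where g = "\<lambda>u. jrem j u - jrem i u"])
  show "continuous_on {a..b} (\<lambda>u. jrem j u - jrem i u)"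
    using a by (intro continuous_intros jrem_continuous) auto
  fix c d assume cd: "a \<le> c" "c \<le> d" "d \<le> b"
    and pos: "\<And>u. c \<le> u \<Longrightarrow> u \<le> d \<Longrightarrow> 0 < jrem j u - jrem i u"
  have "AE u in lborel. c \<le> u \<and> u \<le> d \<longrightarrow> job_rate j u \<le> job_rate i u"
    using AE_serves_before
  proof eventually_elim
    case (elim u)
    show ?case
    proof safe
      assume u: "c \<le> u" "u \<le> d"
      then obtain S where "serves S u" using elim cd a by auto
      moreover have "i \<in> U u" using i U_antimono[of u t] u cd a by auto
      ultimately show "job_rate j u \<le> job_rate i u" using pos[OF u] by (intro serves_priority) auto
    qed
  qed
  then have "processed j d - processed j c \<le> processed i d - processed i c"
    using cd a by (intro cumul_diff_mono job_rate_rate) auto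
  then show "jrem j c - jrem i c \<le> jrem j d - jrem i d" using cd a by (simp add: jrem_eq)
qed (use a gap in auto)

text \<open>Strict inequality between remaining works persists, so two jobs tied at \<open>u\<close> have been tied since
  time \<open>0\<close> and were served alike almost everywhere; this rules out sharing a server among equal jobs.\<close>
lemma job_rate_le_of_jrem_le:
  assumes i: "i \<in> U t" and j: "j < njobs I" and le: "jrem i t \<le> jrem j t"
  shows "AE u in lborel. 0 \<le> u \<and> u \<le> t \<longrightarrow> job_rate j u \<le> job_rate i u"
proof -
  have jU: "j \<in> U t" using i j le t by (simp add: U_iff)
  have nonneg: "jrem i u \<le> jrem j u" if "0 \<le> u" "u \<le> t" for u
    using jrem_gap_mono[OF jU that order_refl, of i] le by fastforce
  define Z where "Z = {u \<in> {0..t}. jrem j u - jrem i u = 0}"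
  have tied: "AE u in lborel. u \<in> Z \<longrightarrow> job_rate j u = job_rate i u"
  proof (cases "Z = {}")
    case False
    have "closed Z" unfolding Z_def
      by (intro continuous_closed_preimage_constant continuous_intros jrem_continuous) auto
    moreover have bdd: "bdd_above Z" by (auto simp: Z_def intro: bdd_aboveI[of _ t])
    ultimately have "Sup Z \<in> Z" using False by (intro closed_contains_Sup)
    define a where "a = Sup Z"
    have a: "0 \<le> a" "a \<le> t" "jrem j a = jrem i a" using \<open>Sup Z \<in> Z\<close> by (auto simp: Z_def a_def)
    have eq: "jrem j v = jrem i v" if v: "0 \<le> v" "v \<le> a" for v
    proof (rule ccontr)
      assume "jrem j v \<noteq> jrem i v"
      then have "jrem i v < jrem j v" using nonneg[of v] v a by auto
      then have "jrem j v - jrem i v \<le> jrem j a - jrem i a" using v a by (intro jrem_gap_mono i) auto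
      then show False using a \<open>jrem i v < jrem j v\<close> by simp
    qed
    have "job_work I j = job_work I i" using eq[of 0] a by (simp add: jrem_eq)
    then have "processed j v = processed i v" if "0 \<le> v" "v \<le> a" for v
      using eq[OF that] that by (simp add: jrem_eq)
    then have "AE u in lborel. 0 \<le> u \<and> u \<le> a \<longrightarrow> job_rate j u = job_rate i u"
      using a by (intro cumul_eq_imp_AE_eq job_rate_rate)
    then show ?thesis
      by eventually_elim (use bdd in \<open>auto simp: a_def Z_def intro: cSup_upper\<close>)
  qed simp
  show ?thesis using AE_serves_before tied
  proof eventually_elim
    case (elim u)
    show ?case
    proof safe
      assume u: "0 \<le> u" "u \<le> t"
      then obtain S where S: "serves S u" using elim by auto
      have iU: "i \<in> U u" using i U_antimono u by blast
      show "job_rate j u \<le> job_rate i u"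
      proof (cases "u \<in> Z")
        case True
        then show ?thesis using elim by simp
      next
        case False
        then have "jrem i u < jrem j u" using nonneg[OF u] u by (auto simp: Z_def)
        then show ?thesis using serves_priority[OF S iU] by simp
      qed
    qed
  qed
qed

lemma not_processed:
  assumes j: "j \<in> U t" and Q: "Q \<subseteq> U t" "card Q = K" "j \<notin> Q" "\<And>i. i \<in> Q \<Longrightarrow> jrem i t \<le> jrem j t"
  shows "processed j t = 0"
proof -
  have fQ: "finite Q" using Q finite_U finite_subset by blast
  have "AE u in lborel. \<forall>i\<in>Q. 0 \<le> u \<and> u \<le> t \<longrightarrow> job_rate j u \<le> job_rate i u"
    using fQ
  proof (rule AE_finite_allI)
    fix i assume "i \<in> Q"
    then show "AE u in lborel. 0 \<le> u \<and> u \<le> t \<longrightarrow> job_rate j u \<le> job_rate i u"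
      using Q j U_subset by (intro job_rate_le_of_jrem_le) blast+
  qed
  then have "AE u in lborel. 0 \<le> u \<and> u \<le> t \<longrightarrow> job_rate j u = 0"
    using AE_serves_before
  proof eventually_elim
    case (elim u)
    show ?case
    proof (rule impI)
      assume u: "0 \<le> u \<and> u \<le> t"
      then obtain S where S: "serves S u" using elim by auto
      have s: "0 < Pinv P (real (n u) / real K)"
        using t u n_antimono[of u t] by (intro speed_pos) auto
      show "job_rate j u = 0"
      proof (rule ccontr)
        assume "job_rate j u \<noteq> 0"
        then have jS: "j \<in> S" using S by (auto simp: serves_def split: if_splits)
        then have jr: "0 < job_rate j u" using S s by (simp add: serves_def)
        have "i \<in> S" if "i \<in> Q" for i
        proof (rule ccontr)
          assume "i \<notin> S"
          then have "job_rate i u = 0" using S by (simp add: serves_def)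
          then show False using elim u that jr by force
        qed
        then have "insert j Q \<subseteq> S" using jS by auto
        moreover have "finite S" using S finite_U finite_subset by (auto simp: serves_def)
        ultimately have "card (insert j Q) \<le> card S" by (intro card_mono)
        then show False using S Q fQ by (simp add: serves_def)
      qed
    qed
  qed
  then show ?thesis using cumul_diff_eq_0[OF job_rate_rate, of 0 t j] t by simp
qed

lemma job_work_le_of_unprocessed:
  assumes x: "x \<in> U t" "processed x t = 0" and i: "0 < processed i t"
  shows "job_work I i \<le> job_work I x"
proof (rule ccontr)
  assume "\<not> ?thesis"
  then have gap: "jrem x 0 < jrem i 0" by (simp add: jrem_eq)
  have "AE u in lborel. 0 \<le> u \<and> u \<le> t \<longrightarrow> job_rate i u \<le> job_rate x u"
    using AE_serves_before
  proof eventually_elim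
    case (elim u)
    show ?case
    proof (rule impI)
      assume u: "0 \<le> u \<and> u \<le> t"
      then obtain S where S: "serves S u" using elim by auto
      have "jrem x u < jrem i u"
        using jrem_gap_mono[OF x(1) order_refl, of u i] u gap by simp
      moreover have "x \<in> U u" using x U_antimono u by blast
      ultimately show "job_rate i u \<le> job_rate x u" using S by (intro serves_priority)
    qed
  qed
  then have "processed i t - processed i 0 \<le> processed x t - processed x 0"
    using t by (intro cumul_diff_mono job_rate_rate) auto
  then show False using x i by simp
qed

lemma card_partly_processed_le: "card {i \<in> U t. 0 < processed i t} \<le> K"
proof (rule ccontr)
  define Y where "Y = {i \<in> U t. 0 < processed i t}"
  have fY: "finite Y" using finite_U by (simp add: Y_def)
  assume "\<not> ?thesis"
  then have K: "K < card Y" by (simp add: Y_def)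
  then have "Y \<noteq> {}" by auto
  then obtain j where j: "j \<in> Y" "\<And>i. i \<in> Y \<Longrightarrow> jrem i t \<le> jrem j t"
    using fY obtains_MAX[of Y "\<lambda>i. jrem i t"] by (metis Max_ge finite_imageI imageI)
  have "K \<le> card (Y - {j})" using K j fY by simp
  then obtain Q where Q: "Q \<subseteq> Y - {j}" "card Q = K"
    using obtain_subset_with_card_n by metis
  have "processed j t = 0"
    using j Q by (intro not_processed[of j Q]) (auto simp: Y_def)
  then show False using j by (simp add: Y_def)
qed

lemma total_processed_le:
  assumes m: "m < n t"
  shows "(\<Sum>i<njobs I. processed i t) \<le> least_work I m + real K * max_work I"
proof -
  define Y where "Y = {i \<in> {..<njobs I}. 0 < processed i t}"
  obtain A where A: "A \<subseteq> {..<njobs I}" "njobs I \<le> card A + m" "least_work I m = sum (job_work I) A"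
    by (rule least_work_attained)
  have "Y \<subseteq> {i \<in> U t. 0 < processed i t} \<union> ({..<njobs I} - U t)" by (auto simp: Y_def)
  then have "card Y \<le> card ({i \<in> U t. 0 < processed i t} \<union> ({..<njobs I} - U t))"
    using finite_U by (intro card_mono) auto
  also have "\<dots> \<le> K + (njobs I - n t)"
    using card_Un_le[of "{i \<in> U t. 0 < processed i t}" "{..<njobs I} - U t"] card_partly_processed_le
      U_subset finite_U by (simp add: card_Diff_subset nunf_def)
  finally have card: "card Y \<le> card A + K" using A m by linarith
  have "0 < njobs I" using m n_le[of t] by linarith
  then have "0 \<le> max_work I"
    using job_work_le_max_work[of 0 I] job_work_pos[OF valid, of 0] by linarith
  have "(\<Sum>i<njobs I. processed i t) = (\<Sum>i\<in>Y. processed i t)"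
    using cumul_nonneg[OF job_rate_rate]
    by (intro sum.mono_neutral_right) (auto simp: Y_def not_less intro: order_antisym)
  also have "\<dots> \<le> sum (job_work I) Y" using t by (intro sum_mono processed_le)
  also have "\<dots> \<le> sum (job_work I) A + real K * max_work I"
  proof (rule sum_smallest_le[OF _ _ card])
    show "finite Y" "finite A" using A finite_subset by (auto simp: Y_def)
    fix i x assume ix: "i \<in> Y" "x \<in> A - Y"
    then have "x < njobs I" using A by auto
    moreover have "processed x t = 0"
      using ix A cumul_nonneg[OF job_rate_rate, of x t] by (auto simp: Y_def not_less intro: order_antisym)
    ultimately have "x \<in> U t"
      using t job_work_pos[OF valid, of x] by (simp add: U_iff jrem_eq)
    then show "job_work I i \<le> job_work I x"
      using ix \<open>processed x t = 0\<close> by (intro job_work_le_of_unprocessed) (auto simp: Y_def)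
  next
    fix i assume "i \<in> Y \<union> A"
    then show "0 \<le> job_work I i" using A by (auto simp: Y_def intro!: less_imp_le job_work_pos[OF valid])
  qed (use \<open>0 \<le> max_work I\<close> in \<open>auto simp: Y_def job_work_le_max_work\<close>)
  finally show ?thesis using A by simp
qed

end

end

section \<open>Cost of job-SRPT schedules\<close>

context srpt_schedule
begin

lemma total_speed_busy:
  assumes rule: "srpt_rule I K P asg spd u" and u: "0 \<le> u" and n: "K \<le> n u"
  shows "total_speed u = real K * Pinv P (real (n u) / real K)"
    and "(\<Sum>i<njobs I. job_rate i u) = total_speed u"
proof -
  show 1: "total_speed u = real K * Pinv P (real (n u) / real K)"
    using u rule_busy(1)[OF rule n] by (simp add: total_speed_def)
  obtain S where S: "serves S u" using rule_serves[OF assms] by blast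
  then have "S \<subseteq> {..<njobs I}" using U_subset by (force simp: serves_def)
  then have "{..<njobs I} \<inter> S = S" by auto
  moreover have "(\<Sum>i<njobs I. job_rate i u)
      = (\<Sum>i<njobs I. if i \<in> S then Pinv P (real (n u) / real K) else 0)"
    using S by (simp add: serves_def)
  ultimately have "(\<Sum>i<njobs I. job_rate i u) = (\<Sum>i\<in>S. Pinv P (real (n u) / real K))"
    by (simp add: sum.inter_restrict[symmetric])
  then show "(\<Sum>i<njobs I. job_rate i u) = total_speed u" using S 1 by (simp add: serves_def)
qed

lemma AE_total_speed_busy:
  "AE u in lborel. 0 \<le> u \<and> K \<le> n u \<longrightarrow> (\<Sum>i<njobs I. job_rate i u) = total_speed u
     \<and> real K * Pinv P 1 \<le> total_speed u"
  using AE_srpt_rule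
proof eventually_elim
  case (elim u)
  have "Pinv P 1 \<le> Pinv P (real (n u) / real K)" if "K \<le> n u"
    using that K_pos by (intro Pinv_mono) auto
  then show ?case using elim total_speed_busy by (auto intro: mult_left_mono)
qed

lemma integral_busy_le:
  "(\<integral>\<^sup>+ u. ennreal (total_speed u) * indicator {..<n u} m * indicator {u. K \<le> n u} u \<partial>lborel)
    \<le> ennreal (least_work I m + real K * max_work I)"
proof -
  define X where "X = {u. 0 \<le> u \<and> m < n u \<and> K \<le> n u}"
  define B where "B = least_work I m + real K * max_work I"
  define f where "f u = (\<Sum>i<njobs I. job_rate i u)" for u
  have f: "rate_function f" unfolding f_def by (intro rate_function_sum job_rate_rate)
  have bound: "cumul f t \<le> B" if "t \<in> X" for t
  proof -
    have "cumul f t = (\<Sum>i<njobs I. processed i t)"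
      unfolding f_def by (intro cumul_sum job_rate_rate)
    then show ?thesis using that total_processed_le[of t m] by (simp add: X_def B_def)
  qed
  have down: "u \<in> X" if "t \<in> X" "0 \<le> u" "u \<le> t" for t u
    using that n_antimono[of u t] by (auto simp: X_def)
  show ?thesis
  proof (cases "X = {}")
    case True
    have "(\<integral>\<^sup>+ u. ennreal (total_speed u) * indicator {..<n u} m * indicator {u. K \<le> n u} u \<partial>lborel)
        = (\<integral>\<^sup>+ u. 0 \<partial>(lborel :: real measure))"
      using True by (intro nn_integral_cong) (auto simp: indicator_def X_def total_speed_def)
    then show ?thesis by simp
  next
    case False
    define c where "c = real K * Pinv P 1"
    have c: "0 < c" using K_pos Pinv_pos[of 1] by (simp add: c_def)
    have le: "t \<le> B / c" if "t \<in> X" for t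
    proof -
      have "AE u in lborel. 0 \<le> u \<and> u \<le> t \<longrightarrow> c \<le> f u"
        using AE_total_speed_busy
        by eventually_elim (use down[OF that] in \<open>auto simp: X_def c_def f_def\<close>)
      then have "cumul (\<lambda>_. c) t - cumul (\<lambda>_. c) 0 \<le> cumul f t - cumul f 0"
        using that c by (intro cumul_diff_mono rate_function_const f) (auto simp: X_def)
      then have "c * t \<le> B" using bound[OF that] that by (simp add: cumul_const X_def)
      then show ?thesis using c by (simp add: field_simps)
    qed
    then have bdd: "bdd_above X" by (intro bdd_aboveI)
    define T where "T = Sup X"
    have T_upper: "u \<le> T" if "u \<in> X" for u unfolding T_def using that bdd by (rule cSup_upper)
    have T0: "0 \<le> T" using False T_upper by (force simp: X_def)
    have "cumul f T \<le> B"
    proof (cases "T = 0")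
      case True
      then have "T \<in> X" using False down T_upper by (metis all_not_in_conv order_refl X_def mem_Collect_eq)
      then show ?thesis by (rule bound)
    next
      case False
      then have "0 < T" using T0 by simp
      have "continuous_on {0..T} (cumul f)" by (rule cumul_continuous[OF f])
      then have "(cumul f \<longlongrightarrow> cumul f T) (at T within {0..T})" using T0 by (auto simp: continuous_on)
      then have "(cumul f \<longlongrightarrow> cumul f T) (at_left T)"
        using \<open>0 < T\<close> by (simp add: at_within_Icc_at_left)
      moreover have "\<forall>\<^sub>F u in at_left T. cumul f u \<le> B"
      proof -
        have "\<forall>\<^sub>F u in at_left T. u \<in> {0<..<T}"
          using \<open>0 < T\<close> by (rule eventually_at_leftI[rotated]) auto
        then show ?thesis
        proof eventually_elim
          case (elim u)
          then obtain t where "t \<in> X" "u < t"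
            using \<open>X \<noteq> {}\<close> bdd by (auto simp: T_def less_cSup_iff)
          then show ?case using down[of t u] elim by (intro bound) auto
        qed
      qed
      ultimately show ?thesis by (intro tendsto_upperbound) auto
    qed
    have "(\<integral>\<^sup>+ u. ennreal (total_speed u) * indicator {..<n u} m * indicator {u. K \<le> n u} u \<partial>lborel)
        \<le> (\<integral>\<^sup>+ u\<in>{0..T}. ennreal (f u) \<partial>lborel)"
    proof (rule nn_integral_mono_AE)
      show "AE u in lborel. ennreal (total_speed u) * indicator {..<n u} m * indicator {u. K \<le> n u} u
          \<le> ennreal (f u) * indicator {0..T} u"
        using AE_total_speed_busy
      proof eventually_elim
        case (elim u)
        show ?case
        proof (cases "u \<in> X")
          case True
          then show ?thesis using elim T_upper[of u] by (auto simp: X_def f_def)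
        next
          case False
          then show ?thesis by (auto simp: X_def indicator_def total_speed_def)
        qed
      qed
    qed
    also have "\<dots> = ennreal (cumul f T)" by (rule ennreal_cumul[OF f, symmetric])
    also have "\<dots> \<le> ennreal B" using \<open>cumul f T \<le> B\<close> by (rule ennreal_leI)
    finally show ?thesis by (simp add: B_def)
  qed
qed

definition tail :: "real set" where
  "tail = {u. 0 \<le> u \<and> 0 < n u \<and> n u < K}"

lemma rule_job_rate_tail:
  assumes rule: "srpt_rule I K P asg spd u" and u: "u \<in> tail" and i: "i \<in> U u"
  shows "Pinv P 1 \<le> job_rate i u"
proof -
  have n: "0 < n u" "n u < K" and u0: "0 \<le> u" using u by (auto simp: tail_def)
  obtain h where h: "h ` U u \<subseteq> {..<K}" "\<forall>i\<in>U u. serves_shortest I K asg spd (h i) i u"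
    using rule_tail(2)[OF rule n] by blast
  have k: "h i < K" using h i by auto
  obtain \<tau> where \<tau>: "asg (h i) u = Some \<tau>" "\<tau> \<in> job_tasks I i"
    using h(2) i by (auto simp: serves_shortest_def job_tasks_def free_tasks_def)
  have "Pinv P 1 = (if \<exists>\<tau>\<in>job_tasks I i. asg (h i) u = Some \<tau> then spd (h i) u else 0)"
    using \<tau> rule_tail(1)[OF rule n] k by auto
  also have "\<dots> \<le> (\<Sum>k<K. if \<exists>\<tau>\<in>job_tasks I i. asg k u = Some \<tau> then spd k u else 0)"
    using k u0 by (intro member_le_sum) (auto simp: spd_nonneg)
  also have "\<dots> = job_rate i u"
    unfolding job_rate_def by (rule sum_rate[OF u0 finite_job_tasks, symmetric])
  finally show ?thesis .
qed

lemma tail_length: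
  assumes "s \<in> tail" "t \<in> tail" "s \<le> t"
  shows "t - s \<le> max_work I / Pinv P 1"
proof -
  have s: "0 \<le> s" "n s < K" and t: "0 < n t" using assms by (auto simp: tail_def)
  obtain i where i: "i \<in> U t" using t by (fastforce simp: nunf_def)
  have "AE u in lborel. s \<le> u \<and> u \<le> t \<longrightarrow> Pinv P 1 \<le> job_rate i u"
    using AE_srpt_rule
  proof eventually_elim
    case (elim u)
    show ?case
    proof (rule impI)
      assume u: "s \<le> u \<and> u \<le> t"
      then have "u \<in> tail" using s t n_antimono[of s u] n_antimono[of u t] by (auto simp: tail_def)
      moreover have "i \<in> U u" using i U_antimono u by blast
      ultimately show "Pinv P 1 \<le> job_rate i u" using elim u s by (intro rule_job_rate_tail) auto
    qed
  qed
  then have "cumul (\<lambda>_. Pinv P 1) t - cumul (\<lambda>_. Pinv P 1) s \<le> processed i t - processed i s"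
    using s assms by (intro cumul_diff_mono rate_function_const job_rate_rate Pinv_nonneg) auto
  then have "Pinv P 1 * (t - s) \<le> processed i t"
    using s assms cumul_nonneg[OF job_rate_rate, of i s] by (simp add: cumul_const algebra_simps)
  also have "\<dots> \<le> max_work I"
    using processed_le[of t i] job_work_le_max_work[of i I] i s assms U_subset[of t] by force
  finally show ?thesis using Pinv_pos[of 1] by (simp add: field_simps)
qed

lemma tail_sets: "tail \<in> sets borel"
proof -
  have "tail = {0..} \<inter> {t. 0 < n t} \<inter> (- {t. K - 1 < n t})" using K_pos by (auto simp: tail_def)
  then show ?thesis using n_greater_sets by auto
qed

lemma emeasure_tail: "emeasure lborel tail \<le> ennreal (max_work I / Pinv P 1)"
proof (cases "tail = {}")
  case False
  have bdd: "bdd_below tail" by (auto simp: tail_def intro: bdd_belowI[of _ 0])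
  obtain t where "t \<in> tail" using False by auto
  then have d: "0 \<le> max_work I / Pinv P 1" using tail_length[of t t] by simp
  have "tail \<subseteq> {Inf tail..Inf tail + max_work I / Pinv P 1}"
  proof
    fix x assume x: "x \<in> tail"
    have "x - max_work I / Pinv P 1 \<le> Inf tail"
    proof (rule cInf_greatest[OF False])
      fix y assume "y \<in> tail"
      then show "x - max_work I / Pinv P 1 \<le> y"
        using tail_length[of y x] x d by (cases "y \<le> x") auto
    qed
    then show "x \<in> {Inf tail..Inf tail + max_work I / Pinv P 1}"
      using cInf_lower[OF x bdd] by auto
  qed
  then have "emeasure lborel tail \<le> emeasure lborel {Inf tail..Inf tail + max_work I / Pinv P 1}"
    by (intro emeasure_mono) auto
  then show ?thesis using d by simp
qed simp

lemma rule_cost_rate: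
  assumes rule: "0 \<le> u \<longrightarrow> srpt_rule I K P asg spd u"
  shows "ennreal (real (n u) + (\<Sum>k<K. P (spd k u))) * indicator {0..} u
    \<le> 2 * (\<Sum>m<njobs I. ennreal (rate_step K m)
          * (ennreal (total_speed u) * indicator {..<n u} m * indicator {u. K \<le> n u} u))
      + ennreal (2 * real K) * indicator tail u"
proof (cases "0 \<le> u")
  case u: True
  note r = rule[rule_format, OF u]
  consider "n u = 0" | "K \<le> n u" | "0 < n u" "n u < K" by linarith
  then show ?thesis
  proof cases
    case 1
    then have "(\<Sum>k<K. P (spd k u)) = 0" using rule_idle[OF r 1] by (simp add: P_0)
    then show ?thesis using 1 by simp
  next
    case 2
    have p: "0 < Pinv P (real (n u) / real K)" using 2 by (rule speed_pos)
    have "(\<Sum>k<K. P (spd k u)) = real (n u)"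
      using rule_busy(1)[OF r 2] K_pos by (simp add: P_Pinv)
    moreover have "energy_rate P (real (n u) / real K) * total_speed u = real (n u)"
      using p K_pos by (simp add: energy_rate_def total_speed_busy(1)[OF r u 2])
    ultimately have "ennreal (real (n u) + (\<Sum>k<K. P (spd k u)))
        = ennreal (2 * (energy_rate P (real (n u) / real K) * total_speed u))" by simp
    also have "\<dots> = 2 * ennreal (energy_rate P (real (n u) / real K) * total_speed u)"
      using total_speed_nonneg by (simp add: ennreal_mult' flip: ennreal_numeral)
    also have "\<dots> = 2 * (\<Sum>m<njobs I. ennreal (rate_step K m)
          * (ennreal (total_speed u) * indicator {..<n u} m))"
      by (simp only: ennreal_energy_rate_layers[OF n_le total_speed_nonneg])
    finally show ?thesis using u 2 by simp
  next
    case 3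
    have "(\<Sum>k<K. P (spd k u)) = real K"
      using rule_tail(1)[OF r 3] by (simp add: P_Pinv)
    moreover have "u \<in> tail" using u 3 by (simp add: tail_def)
    moreover have "ennreal (real (n u) + real K) \<le> ennreal (2 * real K)"
      using 3 by (intro ennreal_leI) simp
    ultimately show ?thesis using u 3 by (simp add: add_increasing del: ennreal_plus)
  qed
qed simp

lemma cost_upper_bound:
  assumes J: "0 < njobs I"
  shows "cost I K P asg spd \<le> ennreal (2 * (\<Sum>m<njobs I. rate_step K m * least_work I m)
     + 2 * (real K * max_work I) * (energy_rate P (real (njobs I) / real K) + 1 / Pinv P 1))"
proof -
  define g where "g m u = ennreal (total_speed u) * indicator {..<n u} m * indicator {u. K \<le> n u} u" for m u
  have "{u. K \<le> n u} = {u. K - 1 < n u}" using K_pos by auto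
  then have "{u. K \<le> n u} \<in> sets borel" using n_greater_sets by simp
  then have g[measurable]: "g m \<in> borel_measurable borel" for m
    unfolding g_def by (intro borel_measurable_times_ennreal layer_measurable borel_measurable_indicator)
  have w: "0 \<le> max_work I"
    using job_work_le_max_work[OF J] job_work_pos[OF valid J] by linarith
  have [measurable]: "tail \<in> sets borel" by (rule tail_sets)
  have "cost I K P asg spd \<le> (\<integral>\<^sup>+ u. 2 * (\<Sum>m<njobs I. ennreal (rate_step K m) * g m u)
      + ennreal (2 * real K) * indicator tail u \<partial>lborel)"
    unfolding cost_def
  proof (rule nn_integral_mono_AE)
    show "AE u in lborel. ennreal (real (n u) + (\<Sum>k<K. P (spd k u))) * indicator {0..} u
        \<le> 2 * (\<Sum>m<njobs I. ennreal (rate_step K m) * g m u) + ennreal (2 * real K) * indicator tail u"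
      using AE_srpt_rule by eventually_elim (unfold g_def, rule rule_cost_rate)
  qed
  also have "\<dots> = 2 * (\<Sum>m<njobs I. ennreal (rate_step K m) * (\<integral>\<^sup>+ u. g m u \<partial>lborel))
      + ennreal (2 * real K) * emeasure lborel tail"
    by (simp add: nn_integral_add nn_integral_cmult nn_integral_sum nn_integral_cmult_indicator)
  also have "\<dots> \<le> 2 * (\<Sum>m<njobs I. ennreal (rate_step K m) * ennreal (least_work I m + real K * max_work I))
      + ennreal (2 * real K) * ennreal (max_work I / Pinv P 1)"
    unfolding g_def
    by (intro add_mono mult_left_mono sum_mono integral_busy_le emeasure_tail) auto
  also have "\<dots> = ennreal (2 * (\<Sum>m<njobs I. rate_step K m * (least_work I m + real K * max_work I))
      + 2 * real K * (max_work I / Pinv P 1))"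
  proof -
    have nn: "0 \<le> least_work I m + real K * max_work I" for m
      using w least_work_nonneg[OF valid] by (intro add_nonneg_nonneg) auto
    have "(\<Sum>m<njobs I. ennreal (rate_step K m) * ennreal (least_work I m + real K * max_work I))
        = ennreal (\<Sum>m<njobs I. rate_step K m * (least_work I m + real K * max_work I))"
      using nn by (subst sum_ennreal[symmetric]) (auto simp: rate_step_nonneg ennreal_mult)
    moreover have "0 \<le> (\<Sum>m<njobs I. rate_step K m * (least_work I m + real K * max_work I))"
      using nn by (intro sum_nonneg mult_nonneg_nonneg rate_step_nonneg) auto
    moreover have "0 \<le> max_work I / Pinv P 1" using w Pinv_nonneg[of 1] by simp
    ultimately show ?thesis
      by (subst ennreal_plus) (auto simp: ennreal_mult mult_nonneg_nonneg simp del: times_divide_eq_right)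
  qed
  also have "(\<Sum>m<njobs I. rate_step K m * (least_work I m + real K * max_work I))
      = (\<Sum>m<njobs I. rate_step K m * least_work I m)
        + energy_rate P (real (njobs I) / real K) * (real K * max_work I)"
    by (simp add: distrib_left sum.distrib sum_distrib_right[symmetric] sum_rate_step)
  finally show ?thesis by (simp add: algebra_simps)
qed

end

theorem theorem1:
  fixes K :: nat and P :: "real \<Rightarrow> real"
    and inst :: "nat \<Rightarrow> jobset"
    and asg :: "nat \<Rightarrow> assignment" and spd :: "nat \<Rightarrow> speeds"
  assumes K: "K \<ge> 1"
    and P: "power_fun_ok P"
    and valid: "\<And>N. valid_instance (inst N)"
    and many_jobs: "filterlim (\<lambda>N. njobs (inst N)) at_top sequentially"
    and scaling: "(\<lambda>N. real K * max_work (inst N) * Delta P (real (njobs (inst N)) / real K)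
                        / total_work (inst N)) \<longlonglongrightarrow> 0"
    and alg: "\<And>N. job_srpt_schedule (inst N) K P (asg N) (spd N)"
  shows "\<forall>\<epsilon>>0. eventually (\<lambda>N. cost (inst N) K P (asg N) (spd N)
                 \<le> ennreal (srpt_bound K P + \<epsilon>) * OPT (inst N) K P) sequentially"
proof (intro allI impI)
  fix \<epsilon> :: real assume \<epsilon>: "0 < \<epsilon>"
  interpret power_function P using P by unfold_locales
  define e where "e = energy_rate P (1 / real K)"
  define c where "c = 1 + 1 / (e * Pinv P 1)"
  have e: "0 < e" using K by (simp add: e_def energy_rate_pos)
  have p: "0 < Pinv P 1" by (simp add: Pinv_pos)
  have c: "0 < c" using e p by (simp add: c_def add_pos_pos)
  have bound: "2 \<le> srpt_bound K P"
  proof -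
    have "1 \<le> 2 - 1 / real K" using K by (simp add: field_simps)
    then have "1 \<le> P (2 - 1 / real K)" using P_1 P_le[of 1 "2 - 1 / real K"] by linarith
    moreover have "2 \<le> 2 + 2 / Pinv P 1 * max 1 (P (sbar P))" using p by simp
    ultimately have "1 * 2 \<le> P (2 - 1 / real K) * (2 + 2 / Pinv P 1 * max 1 (P (sbar P)))"
      by (intro mult_mono) auto
    then show ?thesis by (simp add: srpt_bound_def)
  qed
  have "\<forall>\<^sub>F N in sequentially. real K * max_work (inst N) * Delta P (real (njobs (inst N)) / real K)
      / total_work (inst N) < \<epsilon> * e / (2 * c)"
    using \<epsilon> e c by (intro order_tendstoD(2)[OF scaling]) simp
  moreover have "\<forall>\<^sub>F N in sequentially. 1 \<le> njobs (inst N)"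
    using many_jobs by (simp add: filterlim_at_top)
  ultimately show "\<forall>\<^sub>F N in sequentially. cost (inst N) K P (asg N) (spd N)
      \<le> ennreal (srpt_bound K P + \<epsilon>) * OPT (inst N) K P"
  proof eventually_elim
    case (elim N)
    let ?I = "inst N"
    define J where "J = njobs ?I"
    define L where "L = (\<Sum>m<J. rate_step K m * least_work ?I m)"
    define E where "E = energy_rate P (real J / real K)"
    define D where "D = Delta P (real J / real K)"
    define W where "W = real K * max_work ?I"
    have J: "0 < J" using elim by (simp add: J_def)
    interpret srpt: srpt_schedule ?I K "asg N" "spd N" P
      using alg[of N] valid K by unfold_locales (auto simp: job_srpt_schedule_def)
    have tw: "0 < total_work ?I" unfolding total_work_def
      using J by (intro sum_pos job_work_pos[OF valid]) (auto simp: J_def)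
    have W: "0 \<le> W"
      using job_work_le_max_work[of 0 ?I] job_work_pos[OF valid[of N], of 0] J by (simp add: W_def J_def)
    have "e \<le> E" unfolding e_def E_def using J K by (intro energy_rate_mono) (auto simp: divide_right_mono)
    have "E \<le> D" unfolding D_def E_def using J K by (intro energy_rate_le_Delta) auto
    have "1 / Pinv P 1 \<le> D * (1 / (e * Pinv P 1))"
      using \<open>e \<le> E\<close> \<open>E \<le> D\<close> e p by (simp add: field_simps)
    then have "E + 1 / Pinv P 1 \<le> D * c" using \<open>E \<le> D\<close> by (simp add: c_def algebra_simps)
    then have "2 * W * (E + 1 / Pinv P 1) \<le> 2 * W * (D * c)" using W by (intro mult_left_mono) auto
    also have "\<dots> = W * D * (2 * c)" by simp
    also have "\<dots> \<le> \<epsilon> * (e * total_work ?I)"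
      using elim(1) tw c by (simp add: W_def D_def J_def field_simps)
    also have "e * total_work ?I = (\<Sum>m\<in>{0}. rate_step K m * least_work ?I m)"
      by (simp add: e_def rate_step_def least_work_0)
    also have "\<dots> \<le> L" unfolding L_def
      using J by (intro sum_mono2 mult_nonneg_nonneg rate_step_nonneg least_work_nonneg[OF valid]) auto
    finally have small: "2 * W * (E + 1 / Pinv P 1) \<le> \<epsilon> * L" using \<epsilon> by simp
    have "0 \<le> L" unfolding L_def
      by (intro sum_nonneg mult_nonneg_nonneg rate_step_nonneg least_work_nonneg[OF valid])
    have "ennreal L \<le> OPT ?I K P" unfolding OPT_def
    proof (rule INF_greatest)
      fix s assume "s \<in> {(asg, spd). feasible ?I K asg spd}"
      then interpret opt: powered_schedule ?I K "fst s" "snd s" P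
        using valid K by unfold_locales auto
      show "ennreal L \<le> cost ?I K P (fst s) (snd s)"
        using opt.cost_lower_bound by (simp add: L_def J_def)
    qed
    have "cost ?I K P (asg N) (spd N) \<le> ennreal (2 * L + 2 * W * (E + 1 / Pinv P 1))"
      using srpt.cost_upper_bound J by (simp add: L_def W_def E_def J_def)
    also have "\<dots> \<le> ennreal ((srpt_bound K P + \<epsilon>) * L)"
    proof (rule ennreal_leI)
      have "2 * L \<le> srpt_bound K P * L" using bound \<open>0 \<le> L\<close> by (rule mult_right_mono)
      then show "2 * L + 2 * W * (E + 1 / Pinv P 1) \<le> (srpt_bound K P + \<epsilon>) * L"
        using small by (simp add: distrib_right)
    qed
    also have "\<dots> = ennreal (srpt_bound K P + \<epsilon>) * ennreal L"
      using bound \<epsilon> \<open>0 \<le> L\<close> by (intro ennreal_mult) auto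
    also have "\<dots> \<le> ennreal (srpt_bound K P + \<epsilon>) * OPT ?I K P"
      using \<open>ennreal L \<le> OPT ?I K P\<close> by (rule mult_left_mono) simp
    finally show ?case .
  qed
qed

end
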